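(* Let $T>0$, $Y$ a real normed space, $M\subset\mathbb{R}^n$ open, $\mathbf P\subset Y$ open, $\phi:[0,T]\times M\times\mathbb{R}^n\times\mathbf P\to\mathbb{R}$ a function, $\pi_0\in\mathbf P$, and $\pi\mapsto\mathbf x(\pi)$ a mapping from $\mathbf P$ into $C^1([0,T],M)$. Consider the conditions: (i) $\phi\in C^0([0,T]\times M\times\mathbb{R}^n\times\mathbf P,\mathbb{R})$; (ii) $\pi\mapsto\mathbf x(\pi)$ is continuous at $\pi_0$; (iii) there exist $\varrho>0$ and a Borel $\mathfrak m_1$-integrable $\gamma:[0,T]\to\mathbb{R}_+$ such that for all $t\in[0,T]$, $u,u_1\in B(\mathbf x(\pi_0)(t),\varrho)$, $v,v_1\in B(\mathbf x(\pi_0)'(t),\varrho)$, $\pi,\pi_1\in B(\pi_0,\varrho)$: $|\phi(t,u,v,\pi)-\phi(t,u_1,v_1,\pi_1)|\le\gamma(t)(\|u-u_1\|+\|v-v_1\|+\|\pi-\pi_1\|)$; (iv) for all $t\in[0,T]$ and $\pi\in B(\pi_0,\varrho)$, $D_{H,(2,3,4)}\phi(t,\mathbf x(\pi)(t),\mathbf x(\pi)'(t),\pi)$ exists; (v) for all $t\in[0,T]$, $\pi\mapsto D_{H,(2,3)}\phi(t,\mathbf x(\pi)(t),\mathbf x(\pi)'(t),\pi)$ is continuous on $B(\pi_0,\varrho)$; (vi) for all $t\in[0,T]$, $\pi\mapsto D_{H,(2,3,4)}\phi(t,\mathbf x(\pi)(t),\mathbf x(\pi)'(t),\pi)$ is continuous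 on $B(\pi_0,\varrho)$; (vii) for all $\pi\in B(\pi_0,\varrho)$, $t\mapsto D_{H,(2,3,4)}\phi(t,\mathbf x(\pi)(t),\mathbf x(\pi)'(t),\pi)$ is a Borel function from $[0,T]$ into $(\mathbb{R}^n\times\mathbb{R}^n\times Y)^*$. Let $\Phi:C^1([0,T],M)\times\mathbf P\to\mathbb{R}$, $\Phi(\mathbf x,\pi):=\int_0^T\phi(t,\mathbf x(t),\mathbf x'(t),\pi)\,dt$. Assume (i)–(iii). Then there exists $\sigma\in\,]0,\varrho]$ such that: (a) for all $\pi\in B(\pi_0,\sigma)$, $\mathbf x\mapsto\Phi(\mathbf x,\pi)$ is Lipschitzian on $B_{C^1}(\mathbf x(\pi),\sigma)$; (b) if (iv) also holds, then for all $\pi\in B(\pi_0,\sigma)$, $D_H\Phi(\mathbf x(\pi),\pi)$ exists, and for all $\mathbf h\in C^1([0,T],\mathbb{R}^n)$, $\varpi\in Y$, the function $t\mapsto D_{H,(2,3,4)}\phi(t,\mathbf x(\pi)(t),\mathbf x(\pi)'(t),\pi)\cdot(\mathbf h(t),\mathbf h'(t),\varpi)$ is Borel and $\mathfrak m_1$-integrable on $[0,T]$ and $$D_H\Phi(\mathbf x(\pi),\pi)\cdot(\mathbf h,\varpi)=\int_{[0,T]}D_{H,2}\phi(t,\mathbf x(\pi)(t),\mathbf x(\pi)'(t),\pi)\cdot\mathbf h(t)\,d\mathfrak m_1(t)+\int_{[0,T]}D_{H,3}\phi(t,\mathbf x(\pi)(t),\mathbf x(\pi)'(t),\pi)\cdot\mathbf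 h'(t)\,d\mathfrak m_1(t)+\int_{[0,T]}D_{H,4}\phi(t,\mathbf x(\pi)(t),\mathbf x(\pi)'(t),\pi)\cdot\varpi\,d\mathfrak m_1(t);$$ (c) if (iv) and (v) also hold, then $\pi\mapsto D_{H,1}\Phi(\mathbf x(\pi),\pi)$ is continuous from $B(\pi_0,\sigma)$ into $(C^1([0,T],\mathbb{R}^n))^*$; (d) if (iv)–(vii) also hold, then $\pi\mapsto D_H\Phi(\mathbf x(\pi),\pi)$ is continuous from $B(\pi_0,\sigma)$ into $(C^1([0,T],\mathbb{R}^n)\times Y)^*$.
   Context: $C^1([0,T],M)$ is the set of continuously differentiable functions from $[0,T]$ into $M$, an open subset of $C^1([0,T],\mathbb{R}^n)$ with its usual $C^1$ norm; $B_{C^1}$ denotes balls for this norm; $B(\cdot,r)$ are open balls. The number $\varrho$ in (iii) is understood to be such that $B(\mathbf x(\pi_0)(t),\varrho)\subset M$ for all $t\in[0,T]$ and $B(\pi_0,\varrho)\subset\mathbf P$. $\mathfrak m_1$ is the Borel (Lebesgue) measure on the Borel $\sigma$-algebra of $[0,T]$. Dual spaces carry their usual norms (and Borel $\sigma$-algebras). Hadamard differential: for real normed spaces $E_1,E_2$, $U\subset E_1$ open, $f:U\to E_2$, $x\in U$, $v\in E_1$, $f$ has Hadamard variation $D^+_Hf(x;v)$ if for all sequences $\theta_n>0$, $\theta_n\to0$, and $v_n\to v$, $\frac1{\theta_n}(f(x+\theta_nv_n)-f(x))\to D^+_Hf(x;v)$; if it exists for all $v$ and is continuous linear in $v$, this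 map is $D_Hf(x)$. $D_{H,k}$ is the partial Hadamard differential with respect to the $k$-th variable; $D_{H,(2,3)}$, $D_{H,(2,3,4)}$ are the Hadamard differentials with respect to the indicated variables jointly, the others being fixed. *)

theory Defs
  imports "HOL-Analysis.Analysis" "HOL-Library.Function_Algebras"
begin

text \<open>Pointwise real vector space structure on functions, so that spaces of functions
  can be treated as linear subspaces of a type of class \<open>real_vector\<close>.\<close>

instantiation "fun" :: (type, real_vector) real_vector
begin

definition scaleR_fun :: "real \<Rightarrow> ('a \<Rightarrow> 'b) \<Rightarrow> 'a \<Rightarrow> 'b" where
  "scaleR_fun c f = (\<lambda>t. c *\<^sub>R f t)"

instance
  by standard (simp_all add: scaleR_fun_def fun_eq_iff scaleR_add_right scaleR_add_left)

end


section \<open>Hadamard differentials\<close>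

text \<open>The space of continuously differentiable functions on an interval depends on the
  endpoint, a term, so it is not a type of class \<open>real_normed_vector\<close>. A real
  normed space is therefore given by a linear subspace \<open>V\<close> of a type of class
  \<open>real_vector\<close> with a norm \<open>N\<close> on \<open>V\<close>; a type of class
  \<open>real_normed_vector\<close> is the case \<open>V = UNIV\<close>, \<open>N = norm\<close>.

  The domain of \<open>f\<close> is an open subset of \<open>V\<close> containing \<open>x\<close>. It need not be
  an argument: the points \<open>x + \<theta> n *\<^sub>R w n\<close> below eventually lie in it, so values
  of \<open>f\<close> elsewhere are irrelevant.\<close>

definition has_hadamard_variation ::
  "'a::real_vector set \<Rightarrow> ('a \<Rightarrow> real) \<Rightarrow> ('a \<Rightarrow> 'b::real_normed_vector) \<Rightarrow> 'a \<Rightarrow> 'a \<Rightarrow> 'b \<Rightarrow> bool"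
where
  "has_hadamard_variation V N f x v d \<longleftrightarrow>
    (\<forall>(\<theta>::nat \<Rightarrow> real) (w::nat \<Rightarrow> 'a).
       (\<forall>n. \<theta> n > 0) \<and> \<theta> \<longlonglongrightarrow> 0 \<and> (\<forall>n. w n \<in> V) \<and> (\<lambda>n. N (w n - v)) \<longlonglongrightarrow> 0 \<longrightarrow>
       (\<lambda>n. (1 / \<theta> n) *\<^sub>R (f (x + \<theta> n *\<^sub>R w n) - f x)) \<longlonglongrightarrow> d)"

definition hadamard_differential ::
  "'a::real_vector set \<Rightarrow> ('a \<Rightarrow> real) \<Rightarrow> ('a \<Rightarrow> 'b::real_normed_vector) \<Rightarrow> 'a \<Rightarrow> 'a \<Rightarrow> 'b"
where
  "hadamard_differential V N f x v = (THE d. has_hadamard_variation V N f x v d)"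

definition bounded_linear_on ::
  "'a::real_vector set \<Rightarrow> ('a \<Rightarrow> real) \<Rightarrow> ('a \<Rightarrow> 'b::real_normed_vector) \<Rightarrow> bool"
where
  "bounded_linear_on V N L \<longleftrightarrow>
    (\<forall>v\<in>V. \<forall>w\<in>V. L (v + w) = L v + L w) \<and>
    (\<forall>c. \<forall>v\<in>V. L (c *\<^sub>R v) = c *\<^sub>R L v) \<and>
    (\<exists>K. \<forall>v\<in>V. norm (L v) \<le> K * N v)"

definition hadamard_differentiable ::
  "'a::real_vector set \<Rightarrow> ('a \<Rightarrow> real) \<Rightarrow> ('a \<Rightarrow> 'b::real_normed_vector) \<Rightarrow> 'a \<Rightarrow> bool"
where
  "hadamard_differentiable V N f x \<longleftrightarrow>
    (\<forall>v\<in>V. \<exists>d. has_hadamard_variation V N f x v d) \<and>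
    bounded_linear_on V N (hadamard_differential V N f x)"

definition dual_norm ::
  "'a::real_vector set \<Rightarrow> ('a \<Rightarrow> real) \<Rightarrow> ('a \<Rightarrow> real) \<Rightarrow> real"
where
  "dual_norm V N L = (SUP v\<in>{v\<in>V. N v \<le> 1}. \<bar>L v\<bar>)"

definition continuous_into_dual ::
  "'a::real_vector set \<Rightarrow> ('a \<Rightarrow> real) \<Rightarrow> 'p::topological_space set \<Rightarrow> ('p \<Rightarrow> 'a \<Rightarrow> real) \<Rightarrow> bool"
where
  "continuous_into_dual V N S F \<longleftrightarrow>
    (\<forall>p\<in>S. bounded_linear_on V N (F p)) \<and>
    (\<forall>p\<in>S. ((\<lambda>q. dual_norm V N (\<lambda>v. F q v - F p v)) \<longlongrightarrow> 0) (at p within S))"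


section \<open>Continuously differentiable functions on a compact interval\<close>

text \<open>One-sided at the endpoints.\<close>

definition c1_deriv :: "real \<Rightarrow> (real \<Rightarrow> 'a::real_normed_vector) \<Rightarrow> real \<Rightarrow> 'a" where
  "c1_deriv T x t = vector_derivative x (at t within {0..T})"

text \<open>A function on \<open>{0..T}\<close> is represented by its extension by zero. This makes the
  representation unique, and is compatible with the pointwise linear structure.\<close>

definition C1 :: "real \<Rightarrow> (real \<Rightarrow> 'a::real_normed_vector) set" where
  "C1 T = {x. (\<forall>t\<in>{0..T}. x differentiable (at t within {0..T})) \<and>
              continuous_on {0..T} (c1_deriv T x) \<and>
              (\<forall>t. t \<notin> {0..T} \<longrightarrow> x t = 0)}"

definition C1_into :: "real \<Rightarrow> 'a::real_normed_vector set \<Rightarrow> (real \<Rightarrow> 'a) set" where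
  "C1_into T M = {x \<in> C1 T. \<forall>t\<in>{0..T}. x t \<in> M}"

definition c1_norm :: "real \<Rightarrow> (real \<Rightarrow> 'a::real_normed_vector) \<Rightarrow> real" where
  "c1_norm T x = (SUP t\<in>{0..T}. norm (x t)) + (SUP t\<in>{0..T}. norm (c1_deriv T x t))"

definition c1_ball :: "real \<Rightarrow> (real \<Rightarrow> 'a::real_normed_vector) \<Rightarrow> real \<Rightarrow> (real \<Rightarrow> 'a) set" where
  "c1_ball T x r = {y \<in> C1 T. c1_norm T (y - x) < r}"

definition c1_prod_norm ::
  "real \<Rightarrow> (real \<Rightarrow> 'a::real_normed_vector) \<times> 'y::real_normed_vector \<Rightarrow> real"
where
  "c1_prod_norm T z = c1_norm T (fst z) + norm (snd z)"


section \<open>The integral functional and its integrand\<close>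

definition m1 :: "real \<Rightarrow> real measure" where
  "m1 T = restrict_space lborel {0..T}"

definition Phi ::
  "real \<Rightarrow> (real \<times> (real^'n) \<times> (real^'n) \<times> 'y \<Rightarrow> real) \<Rightarrow>
   (real \<Rightarrow> real^'n) \<times> 'y::real_normed_vector \<Rightarrow> real"
where
  "Phi T \<phi> = (\<lambda>(x, \<pi>). LINT t|m1 T. \<phi> (t, x t, c1_deriv T x t, \<pi>))"

definition D_H2 ::
  "(real \<times> (real^'n) \<times> (real^'n) \<times> 'y::real_normed_vector \<Rightarrow> real) \<Rightarrow>
   real \<Rightarrow> real^'n \<Rightarrow> real^'n \<Rightarrow> 'y \<Rightarrow> real^'n \<Rightarrow> real"
where
  "D_H2 \<phi> t u v \<pi> = hadamard_differential UNIV norm (\<lambda>a. \<phi> (t, a, v, \<pi>)) u"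

definition D_H3 ::
  "(real \<times> (real^'n) \<times> (real^'n) \<times> 'y::real_normed_vector \<Rightarrow> real) \<Rightarrow>
   real \<Rightarrow> real^'n \<Rightarrow> real^'n \<Rightarrow> 'y \<Rightarrow> real^'n \<Rightarrow> real"
where
  "D_H3 \<phi> t u v \<pi> = hadamard_differential UNIV norm (\<lambda>b. \<phi> (t, u, b, \<pi>)) v"

definition D_H4 ::
  "(real \<times> (real^'n) \<times> (real^'n) \<times> 'y::real_normed_vector \<Rightarrow> real) \<Rightarrow>
   real \<Rightarrow> real^'n \<Rightarrow> real^'n \<Rightarrow> 'y \<Rightarrow> 'y \<Rightarrow> real"
where
  "D_H4 \<phi> t u v \<pi> = hadamard_differential UNIV norm (\<lambda>c. \<phi> (t, u, v, c)) \<pi>"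

definition D_H23 ::
  "(real \<times> (real^'n) \<times> (real^'n) \<times> 'y::real_normed_vector \<Rightarrow> real) \<Rightarrow>
   real \<Rightarrow> real^'n \<Rightarrow> real^'n \<Rightarrow> 'y \<Rightarrow> (real^'n) \<times> (real^'n) \<Rightarrow> real"
where
  "D_H23 \<phi> t u v \<pi> = hadamard_differential UNIV norm (\<lambda>(a, b). \<phi> (t, a, b, \<pi>)) (u, v)"

definition D_H234 ::
  "(real \<times> (real^'n) \<times> (real^'n) \<times> 'y::real_normed_vector \<Rightarrow> real) \<Rightarrow>
   real \<Rightarrow> real^'n \<Rightarrow> real^'n \<Rightarrow> 'y \<Rightarrow> (real^'n) \<times> (real^'n) \<times> 'y \<Rightarrow> real"
where
  "D_H234 \<phi> t u v \<pi> = hadamard_differential UNIV norm (\<lambda>(a, b, c). \<phi> (t, a, b, c)) (u, v, \<pi>)"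

definition D_H234_exists ::
  "(real \<times> (real^'n) \<times> (real^'n) \<times> 'y::real_normed_vector \<Rightarrow> real) \<Rightarrow>
   real \<Rightarrow> real^'n \<Rightarrow> real^'n \<Rightarrow> 'y \<Rightarrow> bool"
where
  "D_H234_exists \<phi> t u v \<pi> \<longleftrightarrow>
    hadamard_differentiable UNIV norm (\<lambda>(a, b, c). \<phi> (t, a, b, c)) (u, v, \<pi>)"

text \<open>The values of \<open>D_H23\<close> and \<open>D_H234\<close> are plain functions; where the topology or the Borel
  sigma-algebra of the dual space matters, they are coerced by \<open>Blinfun\<close> to the type of bounded
  linear functionals. The coercion is faithful wherever \<open>D_H234_exists\<close> holds.\<close>

definition cond_iv where
  "cond_iv T \<phi> x \<pi>0 \<rho> \<longleftrightarrow>
    (\<forall>t\<in>{0..T}. \<forall>\<pi>\<in>ball \<pi>0 \<rho>. D_H234_exists \<phi> t (x \<pi> t) (c1_deriv T (x \<pi>) t) \<pi>)"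

definition cond_v where
  "cond_v T \<phi> x \<pi>0 \<rho> \<longleftrightarrow>
    (\<forall>t\<in>{0..T}. continuous_on (ball \<pi>0 \<rho>)
       (\<lambda>\<pi>. Blinfun (D_H23 \<phi> t (x \<pi> t) (c1_deriv T (x \<pi>) t) \<pi>)))"

definition cond_vi where
  "cond_vi T \<phi> x \<pi>0 \<rho> \<longleftrightarrow>
    (\<forall>t\<in>{0..T}. continuous_on (ball \<pi>0 \<rho>)
       (\<lambda>\<pi>. Blinfun (D_H234 \<phi> t (x \<pi> t) (c1_deriv T (x \<pi>) t) \<pi>)))"

definition cond_vii where
  "cond_vii T \<phi> x \<pi>0 \<rho> \<longleftrightarrow>
    (\<forall>\<pi>\<in>ball \<pi>0 \<rho>.
       (\<lambda>t. Blinfun (D_H234 \<phi> t (x \<pi> t) (c1_deriv T (x \<pi>) t) \<pi>))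
         \<in> borel_measurable (restrict_space borel {0..T}))"

end

theory Submission
  imports Defs
begin

text \<open>Difference quotients of the integrand along a bounded family of directions are dominated by
  a multiple of \<open>\<gamma>\<close>, so dominated convergence differentiates under the integral sign; measurability
  of the differential is inherited from the quotients. Continuity into the dual is tested
  along sequences: for \<open>q\<^sub>n\<close> tending to \<open>p\<close> and \<open>v\<^sub>n\<close> in the unit ball, the integrands
  \<open>(D(q\<^sub>n) - D(p)) v\<^sub>n\<close> are measurable and tend to zero pointwise, and dominated convergence applies
  again. In this way the measurability of \<open>t \<mapsto> \<parallel>D(q) - D(p)\<parallel>\<close>, problematic in a nonseparable dual,
  never enters.\<close>

section \<open>Hadamard variations\<close>

text \<open>What makes the Hadamard notion pass through the integral is that it allows the direction
  to vary with the index. Convergence of directions in the C1 norm gives, at each fixed time,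
  convergence of the values and of the derivatives, and hence an admissible direction sequence for
  the integrand; no uniformity in time is needed, since \<gamma> controls the quotients.

  For continuity in the parameter the obstacle is different: near-maximal directions in the unit
  ball need not converge. Pointwise convergence of the functionals would then not be enough in
  general; norm convergence is used because it is uniform on bounded sets. The majorant survives
  because the bound by \<gamma> does not depend on the parameter.

  The recurring \<rho>/2 splits the radius of the Lipschitz condition: one half absorbs the distance
  from the trajectory to the reference trajectory, the other is left for perturbations.\<close>

lemma has_hadamard_variationD:
  assumes "has_hadamard_variation V N f x v d" "\<And>n. \<theta> n > 0" "\<theta> \<longlonglongrightarrow> 0"
    "\<And>n. w n \<in> V" "(\<lambda>n. N (w n - v)) \<longlonglongrightarrow> 0"
  shows "(\<lambda>n. (1 / \<theta> n) *\<^sub>R (f (x + \<theta> n *\<^sub>R w n) - f x)) \<longlonglongrightarrow> d"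
  using assms unfolding has_hadamard_variation_def by simp

text \<open>The constant direction \<open>v\<close> with steps 1/(n+1) is an admissible test
  sequence, and it already determines the limit. Since \<open>N\<close> is an arbitrary function
  here, \<open>N 0 = 0\<close> has to be supplied to make the constant sequence converge to
  \<open>v\<close>.\<close>

lemma hadamard_differential_eqI:
  assumes d: "has_hadamard_variation V N f x v d" and "v \<in> V" "N 0 = 0"
  shows "hadamard_differential V N f x v = d"
  unfolding hadamard_differential_def
proof (rule the_equality)
  show "has_hadamard_variation V N f x v d" by (rule d)
  fix d' assume d': "has_hadamard_variation V N f x v d'"
  have *: "(\<lambda>n. (1 / inverse (real (Suc n))) *\<^sub>R (f (x + inverse (real (Suc n)) *\<^sub>R v) - f x)) \<longlonglongrightarrow> e"
    if "has_hadamard_variation V N f x v e" for e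
    by (rule has_hadamard_variationD[OF that])
      (use assms(2,3) LIMSEQ_inverse_real_of_nat in auto)
  show "d' = d"
    using LIMSEQ_unique[OF *[OF d'] *[OF d]] .
qed

lemma has_hadamard_variation_differential:
  assumes "hadamard_differentiable V N f x" "v \<in> V" "N 0 = 0"
  shows "has_hadamard_variation V N f x v (hadamard_differential V N f x v)"
  using assms hadamard_differential_eqI[of V N f x v]
  unfolding hadamard_differentiable_def by metis

text \<open>Test sequences in the slice are sent by the norm-preserving \<open>J\<close> to test
  sequences in the large space. With \<open>J\<close> filling the other components by zero, this
  yields every partial differential below, those of \<phi> as well as that of
  \<open>Phi\<close>.\<close>

lemma has_hadamard_variation_slice:
  assumes f: "has_hadamard_variation V N f x (J v) d"
    and J: "\<And>w. w \<in> W \<Longrightarrow> J w \<in> V"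
    and N: "\<And>w. w \<in> W \<Longrightarrow> N (J w - J v) = N' (w - v)"
    and g: "\<And>\<theta> w. w \<in> W \<Longrightarrow> g (y + \<theta> *\<^sub>R w) = f (x + \<theta> *\<^sub>R J w)" "g y = f x"
  shows "has_hadamard_variation W N' g y v d"
  unfolding has_hadamard_variation_def
proof (intro allI impI, elim conjE)
  fix \<theta> :: "nat \<Rightarrow> real" and w
  assume "\<forall>n. \<theta> n > 0" "\<theta> \<longlonglongrightarrow> 0" and w: "\<forall>n. w n \<in> W" and "(\<lambda>n. N' (w n - v)) \<longlonglongrightarrow> 0"
  then have "(\<lambda>n. (1 / \<theta> n) *\<^sub>R (f (x + \<theta> n *\<^sub>R J (w n)) - f x)) \<longlonglongrightarrow> d"
    by (intro has_hadamard_variationD[OF f]) (use J N in auto)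
  then show "(\<lambda>n. (1 / \<theta> n) *\<^sub>R (g (y + \<theta> n *\<^sub>R w n) - g y)) \<longlonglongrightarrow> d"
    using g w by simp
qed

lemma bounded_linear_on_UNIV:
  assumes "bounded_linear_on UNIV norm L"
  shows "bounded_linear L"
proof -
  obtain K where "\<And>v. norm (L v) \<le> K * norm v"
    using assms unfolding bounded_linear_on_def by auto
  then show ?thesis
    using assms unfolding bounded_linear_on_def
    by (intro bounded_linear_intro[where K=K]) (auto simp: mult.commute)
qed

text \<open>A Hadamard differential is identified only at directions in \<open>V\<close>. Closure of
  \<open>V\<close> under the linear operations keeps sums and multiples where the identification
  holds.\<close>

lemma bounded_linear_on_cong:
  assumes "bounded_linear_on V N F" "\<And>v. v \<in> V \<Longrightarrow> G v = F v"
    "\<And>v w. v \<in> V \<Longrightarrow> w \<in> V \<Longrightarrow> v + w \<in> V" "\<And>c v. v \<in> V \<Longrightarrow> c *\<^sub>R v \<in> V"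
  shows "bounded_linear_on V N G"
  using assms unfolding bounded_linear_on_def by auto

lemma norm_triple_le:
  "norm (a :: 'a::real_normed_vector, b :: 'b::real_normed_vector, c :: 'c::real_normed_vector)
    \<le> norm a + norm b + norm c"
  using norm_Pair_le[of a "(b, c)"] norm_Pair_le[of b c] by linarith

text \<open>The supremum in \<open>dual_norm\<close> need not be attained, so it is replaced at
  index n by its value at a direction that is maximal up to 1/(n+1). Convergence in the dual thus
  reduces to scalar sequences with varying directions, on which integral estimates can act.\<close>

lemma continuous_into_dualI:
  fixes S :: "'p::metric_space set"
  assumes V: "0 \<in> V" "N 0 = 0" and N: "\<And>v. v \<in> V \<Longrightarrow> 0 \<le> N v"
    and bl: "\<And>p. p \<in> S \<Longrightarrow> bounded_linear_on V N (F p)"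
    and lim: "\<And>p q v. p \<in> S \<Longrightarrow> (\<And>n. q n \<in> S) \<Longrightarrow> q \<longlonglongrightarrow> p \<Longrightarrow> (\<And>n. v n \<in> V) \<Longrightarrow>
        (\<And>n. N (v n) \<le> 1) \<Longrightarrow> (\<lambda>n. F (q n) (v n) - F p (v n)) \<longlonglongrightarrow> 0"
  shows "continuous_into_dual V N S F"
  unfolding continuous_into_dual_def
proof (intro conjI ballI)
  fix p assume p: "p \<in> S"
  let ?U = "{v \<in> V. N v \<le> 1}"
  show "((\<lambda>q. dual_norm V N (\<lambda>v. F q v - F p v)) \<longlongrightarrow> 0) (at p within S)"
    unfolding tendsto_at_iff_sequentially
  proof (intro allI impI, unfold comp_def)
    fix q assume qS: "\<forall>i. q i \<in> S - {p}" and qp: "q \<longlonglongrightarrow> p"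
    define G where "G n = (\<lambda>v. F (q n) v - F p v)" for n
    \<comment> \<open>A real supremum has its order properties only for bounded sets, so boundedness
      is established before \<open>dual_norm\<close> is compared with anything.\<close>
    have bdd: "bdd_above ((\<lambda>v. \<bar>G n v\<bar>) ` ?U)" for n
    proof -
      obtain K where K: "\<And>v. v \<in> V \<Longrightarrow> \<bar>F (q n) v\<bar> \<le> K * N v"
        using bl[of "q n"] qS unfolding bounded_linear_on_def real_norm_def by blast
      obtain K' where K': "\<And>v. v \<in> V \<Longrightarrow> \<bar>F p v\<bar> \<le> K' * N v"
        using bl[OF p] unfolding bounded_linear_on_def real_norm_def by blast
      \<comment> \<open>The constants \<open>K\<close> and \<open>K'\<close> carry no sign, hence
        the absolute values when \<open>N v \<le> 1\<close> is used.\<close>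
      have "\<bar>G n v\<bar> \<le> \<bar>K\<bar> + \<bar>K'\<bar>" if v: "v \<in> ?U" for v
      proof -
        have "c * N v \<le> \<bar>c\<bar>" for c
          using v N[of v] mult_mono[of c "\<bar>c\<bar>" "N v" 1] by auto
        from this[of K] this[of K'] show ?thesis
          using K[of v] K'[of v] v unfolding G_def by auto
      qed
      then show ?thesis by (intro bdd_aboveI2)
    qed
    have "0 \<le> dual_norm V N (G n)" for n
      unfolding dual_norm_def using V by (intro cSUP_upper2[OF bdd, of 0]) auto
    moreover have "\<exists>v\<in>?U. dual_norm V N (G n) - 1 / real (Suc n) < \<bar>G n v\<bar>" for n
    proof (subst less_cSUP_iff[symmetric])
      show "?U \<noteq> {}" using V by auto
      show "dual_norm V N (G n) - 1 / real (Suc n) < (SUP v\<in>?U. \<bar>G n v\<bar>)"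
        by (simp add: dual_norm_def)
    qed (rule bdd)
    then obtain v where v: "\<And>n. v n \<in> ?U" "\<And>n. dual_norm V N (G n) - 1 / real (Suc n) < \<bar>G n (v n)\<bar>"
      by metis
    have "(\<lambda>n. \<bar>G n (v n)\<bar> + 1 / real (Suc n)) \<longlonglongrightarrow> 0 + 0"
      using lim[OF p _ qp, of v] qS v(1) LIMSEQ_inverse_real_of_nat
      by (intro tendsto_add tendsto_rabs_zero) (auto simp: G_def inverse_eq_divide)
    then have "(\<lambda>n. \<bar>G n (v n)\<bar> + 1 / real (Suc n)) \<longlonglongrightarrow> 0" by simp
    moreover have "dual_norm V N (G n) \<le> \<bar>G n (v n)\<bar> + 1 / real (Suc n)" for n
      using v(2)[of n] by linarith
    ultimately have "(\<lambda>n. dual_norm V N (G n)) \<longlonglongrightarrow> 0"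
      by - (rule Lim_null_comparison[where g = "\<lambda>n. \<bar>G n (v n)\<bar> + 1 / real (Suc n)"], auto)
    then show "(\<lambda>n. dual_norm V N (\<lambda>v. F (q n) v - F p v)) \<longlonglongrightarrow> 0"
      unfolding G_def .
  qed
qed (use bl in auto)

text \<open>The arguments \<open>z n\<close> are only bounded, not convergent: the operator norm of
  the difference times \<open>K\<close> dominates. Bounded linearity of each \<open>L p\<close>
  ensures that \<open>Blinfun\<close> does not alter the functional.\<close>

lemma Blinfun_continuous_tendsto_diff:
  fixes L :: "'p::metric_space \<Rightarrow> 'a::real_normed_vector \<Rightarrow> real"
  assumes cont: "continuous_on S (\<lambda>p. Blinfun (L p))"
    and bl: "\<And>p. p \<in> S \<Longrightarrow> bounded_linear (L p)"
    and q: "\<And>n. q n \<in> S" "q \<longlonglongrightarrow> p" "p \<in> S"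
    and z: "\<And>n. norm (z n) \<le> K"
  shows "(\<lambda>n. L (q n) (z n) - L p (z n)) \<longlonglongrightarrow> 0"
proof -
  define B where "B p = Blinfun (L p)" for p
  have B: "L p z = blinfun_apply (B p) z" if "p \<in> S" for p z
    using bl[OF that] by (simp add: B_def bounded_linear_Blinfun_apply)
  have "(\<lambda>n. B (q n)) \<longlonglongrightarrow> B p"
    using cont q unfolding continuous_on_sequentially comp_def B_def by blast
  then have "(\<lambda>n. norm (B (q n) - B p) * K) \<longlonglongrightarrow> 0"
    using tendsto_mult_left_zero tendsto_norm_zero LIM_zero by blast
  moreover have "norm (L (q n) (z n) - L p (z n)) \<le> norm (B (q n) - B p) * K" for n
    using norm_blinfun[of "B (q n) - B p" "z n"] mult_left_mono[OF z[of n], of "norm (B (q n) - B p)"]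
    by (simp add: B q blinfun.diff_left)
  ultimately show ?thesis
    by - (rule Lim_null_comparison[of _ "\<lambda>n. norm (B (q n) - B p) * K"], auto)
qed


section \<open>The space of continuously differentiable functions\<close>

lemma C1_has_deriv:
  assumes "x \<in> C1 T" "t \<in> {0..T}"
  shows "(x has_vector_derivative c1_deriv T x t) (at t within {0..T})"
  using assms unfolding C1_def c1_deriv_def by (auto simp: vector_derivative_works)

text \<open>For \<open>T > 0\<close> every point of the interval, endpoints included, is a limit
  point of it, so the derivative within the interval is unique.\<close>

lemma c1_deriv_eqI:
  assumes "T > 0" "t \<in> {0..T}" "(x has_vector_derivative d) (at t within {0..T})"
  shows "c1_deriv T x t = d"
  unfolding c1_deriv_def using assms
  by (intro vector_derivative_within) (auto simp: trivial_limit_within islimpt_Icc)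

lemma C1_I:
  assumes "T > 0" "\<And>t. t \<in> {0..T} \<Longrightarrow> (x has_vector_derivative d t) (at t within {0..T})"
    "continuous_on {0..T} d" "\<And>t. t \<notin> {0..T} \<Longrightarrow> x t = 0"
  shows "x \<in> C1 T"
proof -
  have "continuous_on {0..T} (c1_deriv T x)"
    using assms(3) by (rule continuous_on_eq) (use c1_deriv_eqI[OF assms(1) _ assms(2)] in auto)
  then show ?thesis
    using differentiableI_vector[OF assms(2)] assms(4) unfolding C1_def by blast
qed

context
  fixes T :: real
  assumes T: "T > 0"
begin

lemma c1_deriv_add:
  assumes "x \<in> C1 T" "y \<in> C1 T" "t \<in> {0..T}"
  shows "c1_deriv T (x + y) t = c1_deriv T x t + c1_deriv T y t"
  using C1_has_deriv[OF assms(1,3)] C1_has_deriv[OF assms(2,3)] assms(3)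
  by (intro c1_deriv_eqI T) (auto simp: plus_fun_def intro: has_vector_derivative_add)

lemma c1_deriv_diff:
  assumes "x \<in> C1 T" "y \<in> C1 T" "t \<in> {0..T}"
  shows "c1_deriv T (x - y) t = c1_deriv T x t - c1_deriv T y t"
  using C1_has_deriv[OF assms(1,3)] C1_has_deriv[OF assms(2,3)] assms(3)
  by (intro c1_deriv_eqI T) (auto simp: fun_diff_def intro: has_vector_derivative_diff)

lemma c1_deriv_scaleR:
  assumes "x \<in> C1 T" "t \<in> {0..T}"
  shows "c1_deriv T (c *\<^sub>R x) t = c *\<^sub>R c1_deriv T x t"
  using bounded_linear.has_vector_derivative[OF bounded_linear_scaleR_right C1_has_deriv[OF assms]]
    assms(2)
  by (intro c1_deriv_eqI T) (auto simp: scaleR_fun_def)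

lemma C1_continuous_on:
  assumes "x \<in> C1 T"
  shows "continuous_on {0..T} x" "continuous_on {0..T} (c1_deriv T x)"
  using assms unfolding C1_def
  by (auto simp: continuous_on_eq_continuous_within intro: differentiable_imp_continuous_within)

lemma C1_add: "x \<in> C1 T \<Longrightarrow> y \<in> C1 T \<Longrightarrow> x + y \<in> C1 T"
  using C1_has_deriv[of x T] C1_has_deriv[of y T] C1_continuous_on[of x] C1_continuous_on[of y]
  by (intro C1_I[where d = "\<lambda>t. c1_deriv T x t + c1_deriv T y t"] T)
    (auto simp: plus_fun_def C1_def intro!: has_vector_derivative_add continuous_on_add)

lemma C1_diff: "x \<in> C1 T \<Longrightarrow> y \<in> C1 T \<Longrightarrow> x - y \<in> C1 T"
  using C1_has_deriv[of x T] C1_has_deriv[of y T] C1_continuous_on[of x] C1_continuous_on[of y]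
  by (intro C1_I[where d = "\<lambda>t. c1_deriv T x t - c1_deriv T y t"] T)
    (auto simp: fun_diff_def C1_def intro!: has_vector_derivative_diff continuous_on_diff)

lemma C1_scaleR: "x \<in> C1 T \<Longrightarrow> c *\<^sub>R x \<in> C1 T"
  using bounded_linear.has_vector_derivative[OF bounded_linear_scaleR_right C1_has_deriv[of x T]]
    C1_continuous_on[of x]
  by (intro C1_I[where d = "\<lambda>t. c *\<^sub>R c1_deriv T x t"] T)
    (auto simp: scaleR_fun_def C1_def intro!: continuous_on_scaleR)

lemma c1_deriv_zero: "t \<in> {0..T} \<Longrightarrow> c1_deriv T 0 t = 0"
  by (intro c1_deriv_eqI T) (auto simp: zero_fun_def)

lemma C1_zero: "0 \<in> C1 T"
  by (intro C1_I[where d = "\<lambda>t. 0"] T) (auto simp: zero_fun_def)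

lemma c1_norm_zero: "c1_norm T 0 = 0"
  using T by (simp add: c1_norm_def c1_deriv_zero)

text \<open>The bridge from \<open>c1_norm\<close> to estimates at a single time. Continuity on the
  compact interval bounds both families, so the suprema are genuine upper bounds.\<close>

lemma norm_le_c1_norm:
  assumes "x \<in> C1 T" "t \<in> {0..T}"
  shows "norm (x t) + norm (c1_deriv T x t) \<le> c1_norm T x"
proof -
  have "bdd_above ((\<lambda>t. norm (f t)) ` {0..T})" if "continuous_on {0..T} f" for f :: "real \<Rightarrow> 'a"
    using that by (intro bounded_imp_bdd_above compact_imp_bounded compact_continuous_image
        continuous_on_norm) auto
  then show ?thesis
    unfolding c1_norm_def using C1_continuous_on[OF assms(1)] assms(2)
    by (intro add_mono cSUP_upper) auto
qed

lemma norm_le_c1_norm_diff: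
  assumes "x \<in> C1 T" "y \<in> C1 T" "t \<in> {0..T}"
  shows "norm (x t - y t) + norm (c1_deriv T x t - c1_deriv T y t) \<le> c1_norm T (x - y)"
  using norm_le_c1_norm[OF C1_diff[OF assms(1,2)] assms(3)] c1_deriv_diff[OF assms] by simp

lemma c1_norm_nonneg: "x \<in> C1 T \<Longrightarrow> 0 \<le> c1_norm T x"
  using norm_le_c1_norm[of x 0] T by (auto intro: order_trans[rotated])

end

section \<open>Integration over the interval\<close>

lemma space_m1 [simp]: "space (m1 T) = {0..T}"
  by (simp add: m1_def space_restrict_space)

lemma integrable_m1_continuous:
  fixes f :: "real \<Rightarrow> real"
  assumes "continuous_on {0..T} f"
  shows "integrable (m1 T) f"
  using borel_integrable_compact[of "{0..T}" f] assms
  by (simp add: m1_def integrable_restrict_space set_integrable_def)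

text \<open>Convergence is asked at every point of the interval, not just almost everywhere:
  \<open>m1\<close> is defined on the Borel sets only and is not complete, and everywhere
  convergence makes the limit Borel without a separate assumption.\<close>

lemma dominated_convergence_m1:
  fixes s :: "nat \<Rightarrow> real \<Rightarrow> real"
  assumes s: "\<And>n. integrable (m1 T) (s n)" and g: "integrable (m1 T) g"
    and bd: "\<And>n t. t \<in> {0..T} \<Longrightarrow> \<bar>s n t\<bar> \<le> g t"
    and lim: "\<And>t. t \<in> {0..T} \<Longrightarrow> (\<lambda>n. s n t) \<longlonglongrightarrow> f t"
  shows "integrable (m1 T) f" "(\<lambda>n. LINT t|m1 T. s n t) \<longlonglongrightarrow> (LINT t|m1 T. f t)"
proof -
  have m: "\<And>n. s n \<in> borel_measurable (m1 T)" using s by blast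
  have f: "f \<in> borel_measurable (m1 T)"
    by (rule borel_measurable_LIMSEQ_real[where u = s]) (use lim m in auto)
  show "integrable (m1 T) f"
    by (rule integrable_dominated_convergence[where s = s and w = g]) (use f m g bd lim in auto)
  show "(\<lambda>n. LINT t|m1 T. s n t) \<longlonglongrightarrow> (LINT t|m1 T. f t)"
    by (rule integral_dominated_convergence[where s = s and w = g]) (use f m g bd lim in auto)
qed


section \<open>Differentiation under the integral sign\<close>

text \<open>The radius \<sigma> is fixed before any differentiability condition appears, so that one
  radius serves all four claims. The assumption \<open>near\<close> is the form in which continuity
  of the trajectory at \<pi>0 is used.\<close>

locale integral_functional =
  fixes T :: real
    and M :: "(real^'n) set"
    and P :: "'y::real_normed_vector set"
    and \<phi> :: "real \<times> (real^'n) \<times> (real^'n) \<times> 'y \<Rightarrow> real"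
    and \<pi>0 :: 'y
    and x :: "'y \<Rightarrow> real \<Rightarrow> real^'n"
    and \<rho> \<sigma> :: real
    and \<gamma> :: "real \<Rightarrow> real"
  assumes T: "T > 0"
    and x: "\<And>\<pi>. \<pi> \<in> P \<Longrightarrow> x \<pi> \<in> C1_into T M"
    and cont: "continuous_on ({0..T} \<times> M \<times> UNIV \<times> P) \<phi>"
    and ball_M: "\<And>t. t \<in> {0..T} \<Longrightarrow> ball (x \<pi>0 t) \<rho> \<subseteq> M"
    and ball_P: "ball \<pi>0 \<rho> \<subseteq> P"
    and \<gamma>: "integrable (m1 T) \<gamma>" "\<And>t. t \<in> {0..T} \<Longrightarrow> 0 \<le> \<gamma> t"
    and lip: "\<And>t u u1 v v1 \<pi> \<pi>1. t \<in> {0..T} \<Longrightarrow>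
        u \<in> ball (x \<pi>0 t) \<rho> \<Longrightarrow> u1 \<in> ball (x \<pi>0 t) \<rho> \<Longrightarrow>
        v \<in> ball (c1_deriv T (x \<pi>0) t) \<rho> \<Longrightarrow> v1 \<in> ball (c1_deriv T (x \<pi>0) t) \<rho> \<Longrightarrow>
        \<pi> \<in> ball \<pi>0 \<rho> \<Longrightarrow> \<pi>1 \<in> ball \<pi>0 \<rho> \<Longrightarrow>
        \<bar>\<phi> (t, u, v, \<pi>) - \<phi> (t, u1, v1, \<pi>1)\<bar>
          \<le> \<gamma> t * (norm (u - u1) + norm (v - v1) + norm (\<pi> - \<pi>1))"
    and \<sigma>: "0 < \<sigma>" "\<sigma> \<le> \<rho> / 2"
    and near: "\<And>\<pi>. \<pi> \<in> ball \<pi>0 \<sigma> \<Longrightarrow> c1_norm T (x \<pi> - x \<pi>0) < \<rho> / 2"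
begin

abbreviation D where
  "D t \<pi> \<equiv> D_H234 \<phi> t (x \<pi> t) (c1_deriv T (x \<pi>) t) \<pi>"

abbreviation x' where
  "x' \<pi> \<equiv> c1_deriv T (x \<pi>)"

section \<open>Room for perturbations and bounds on difference quotients\<close>

lemma ball_\<sigma>: "\<pi> \<in> ball \<pi>0 \<sigma> \<Longrightarrow> \<pi> \<in> ball \<pi>0 \<rho>" "\<pi> \<in> ball \<pi>0 \<sigma> \<Longrightarrow> \<pi> \<in> P"
  using \<sigma> ball_P by (auto simp: subset_eq)

lemma x_C1: "\<pi> \<in> ball \<pi>0 \<sigma> \<Longrightarrow> x \<pi> \<in> C1 T" "x \<pi>0 \<in> C1 T"
  using x ball_\<sigma> \<sigma> by (auto simp: C1_into_def)

text \<open>Triangle inequality with two halves of \<rho>: \<open>near\<close> and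
  \<open>\<sigma> \<le> \<rho> / 2\<close> bound the distance to the reference point, and the
  perturbation takes the rest.\<close>

lemma near_ball:
  assumes "\<pi> \<in> ball \<pi>0 \<sigma>" "t \<in> {0..T}" "norm a < \<rho> / 2" "norm b < \<rho> / 2" "norm c < \<rho> / 2"
  shows "x \<pi> t + a \<in> ball (x \<pi>0 t) \<rho>" "x' \<pi> t + b \<in> ball (x' \<pi>0 t) \<rho>" "\<pi> + c \<in> ball \<pi>0 \<rho>"
proof -
  have *: "z + d \<in> ball z0 \<rho>" if "norm (z - z0) < \<rho> / 2" "norm d < \<rho> / 2"
    for z z0 d :: "'z::real_normed_vector"
    using norm_triangle_ineq[of "z - z0" d] that by (simp add: dist_norm norm_minus_commute algebra_simps)
  have "norm (x \<pi> t - x \<pi>0 t) + norm (x' \<pi> t - x' \<pi>0 t) < \<rho> / 2"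
    using norm_le_c1_norm_diff[OF T x_C1(1)[OF assms(1)] x_C1(2) assms(2)] near[OF assms(1)] by simp
  then have "norm (x \<pi> t - x \<pi>0 t) < \<rho> / 2" "norm (x' \<pi> t - x' \<pi>0 t) < \<rho> / 2"
    using norm_ge_zero[of "x \<pi> t - x \<pi>0 t"] norm_ge_zero[of "x' \<pi> t - x' \<pi>0 t"] by linarith+
  moreover have "norm (\<pi> - \<pi>0) < \<rho> / 2"
    using assms(1) \<sigma> by (simp add: dist_norm norm_minus_commute)
  ultimately show "x \<pi> t + a \<in> ball (x \<pi>0 t) \<rho>" "x' \<pi> t + b \<in> ball (x' \<pi>0 t) \<rho>" "\<pi> + c \<in> ball \<pi>0 \<rho>"
    using * assms by blast+
qed

text \<open>The integrand is continuous in time along continuous arguments, hence integrable on a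
  compact interval. Only the first argument has a domain \<open>M\<close> to respect; the velocity
  is unrestricted.\<close>

lemma integrable_integrand:
  assumes "continuous_on {0..T} a" "continuous_on {0..T} b" "\<And>t. t \<in> {0..T} \<Longrightarrow> a t \<in> M" "c \<in> P"
  shows "integrable (m1 T) (\<lambda>t. \<phi> (t, a t, b t, c))"
  by (intro integrable_m1_continuous continuous_on_compose2[OF cont])
    (use assms in \<open>auto intro!: continuous_intros\<close>)

text \<open>Both points lie in the balls of the Lipschitz condition, and the step \<theta> cancels.
  The resulting bound is free of \<theta>, as a dominating function must be.\<close>

lemma quotient_bound:
  assumes "\<pi> \<in> ball \<pi>0 \<sigma>" "t \<in> {0..T}" "\<theta> > 0"
    "norm (\<theta> *\<^sub>R a) < \<rho> / 2" "norm (\<theta> *\<^sub>R b) < \<rho> / 2" "norm (\<theta> *\<^sub>R c) < \<rho> / 2"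
  shows "\<bar>1 / \<theta> * (\<phi> (t, x \<pi> t + \<theta> *\<^sub>R a, x' \<pi> t + \<theta> *\<^sub>R b, \<pi> + \<theta> *\<^sub>R c) - \<phi> (t, x \<pi> t, x' \<pi> t, \<pi>))\<bar>
    \<le> \<gamma> t * (norm a + norm b + norm c)"
proof -
  have "\<bar>\<phi> (t, x \<pi> t + \<theta> *\<^sub>R a, x' \<pi> t + \<theta> *\<^sub>R b, \<pi> + \<theta> *\<^sub>R c) - \<phi> (t, x \<pi> t, x' \<pi> t, \<pi>)\<bar>
      \<le> \<gamma> t * (norm (x \<pi> t + \<theta> *\<^sub>R a - x \<pi> t) + norm (x' \<pi> t + \<theta> *\<^sub>R b - x' \<pi> t) + norm (\<pi> + \<theta> *\<^sub>R c - \<pi>))"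
    using near_ball[OF assms(1,2), of "\<theta> *\<^sub>R a" "\<theta> *\<^sub>R b" "\<theta> *\<^sub>R c"]
      near_ball[OF assms(1,2), of 0 0 0] assms \<sigma>
    by (intro lip) auto
  also have "\<dots> = \<theta> * (\<gamma> t * (norm a + norm b + norm c))"
    using assms(3) by (simp add: algebra_simps)
  finally show ?thesis
    using assms(3) by (simp add: abs_mult divide_simps mult.commute)
qed

lemma quotient_tendsto:
  assumes iv: "cond_iv T \<phi> x \<pi>0 \<rho>" and \<pi>: "\<pi> \<in> ball \<pi>0 \<rho>" and t: "t \<in> {0..T}"
    and \<theta>: "\<And>n. \<theta> n > 0" "\<theta> \<longlonglongrightarrow> 0" and "a \<longlonglongrightarrow> a'" "b \<longlonglongrightarrow> b'" "c \<longlonglongrightarrow> c'"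
  shows "(\<lambda>n. 1 / \<theta> n * (\<phi> (t, x \<pi> t + \<theta> n *\<^sub>R a n, x' \<pi> t + \<theta> n *\<^sub>R b n, \<pi> + \<theta> n *\<^sub>R c n)
      - \<phi> (t, x \<pi> t, x' \<pi> t, \<pi>))) \<longlonglongrightarrow> D t \<pi> (a', b', c')"
proof -
  have "has_hadamard_variation UNIV norm (\<lambda>(a, b, c). \<phi> (t, a, b, c)) (x \<pi> t, x' \<pi> t, \<pi>) (a', b', c')
      (D t \<pi> (a', b', c'))"
    using iv \<pi> t unfolding cond_iv_def D_H234_exists_def D_H234_def
    by (intro has_hadamard_variation_differential) auto
  moreover have "(\<lambda>n. (a n, b n, c n)) \<longlonglongrightarrow> (a', b', c')"
    using assms by (intro tendsto_Pair)
  then have "(\<lambda>n. norm ((a n, b n, c n) - (a', b', c'))) \<longlonglongrightarrow> 0"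
    using LIM_zero tendsto_norm_zero by blast
  ultimately have "(\<lambda>n. (1 / \<theta> n) *\<^sub>R ((\<lambda>(a, b, c). \<phi> (t, a, b, c))
      ((x \<pi> t, x' \<pi> t, \<pi>) + \<theta> n *\<^sub>R (a n, b n, c n))
      - (\<lambda>(a, b, c). \<phi> (t, a, b, c)) (x \<pi> t, x' \<pi> t, \<pi>))) \<longlonglongrightarrow> D t \<pi> (a', b', c')"
    by - (rule has_hadamard_variationD, assumption, rule \<theta>, rule \<theta>, rule UNIV_I, assumption)
  then show ?thesis by simp
qed

lemma D_bounded_linear:
  assumes "cond_iv T \<phi> x \<pi>0 \<rho>" "\<pi> \<in> ball \<pi>0 \<rho>" "t \<in> {0..T}"
  shows "bounded_linear (D t \<pi>)"
  using assms unfolding cond_iv_def D_H234_exists_def D_H234_def hadamard_differentiable_def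
  by (intro bounded_linear_on_UNIV) auto

text \<open>The quotient bound passes to the limit along fixed directions. Being independent of
  \<pi>, it lets \<gamma> dominate the differentials on the whole ball at once.\<close>

lemma D_bound:
  assumes iv: "cond_iv T \<phi> x \<pi>0 \<rho>" and \<pi>: "\<pi> \<in> ball \<pi>0 \<sigma>" and t: "t \<in> {0..T}"
  shows "\<bar>D t \<pi> (a, b, c)\<bar> \<le> \<gamma> t * (norm a + norm b + norm c)"
proof (rule tendsto_upperbound)
  define \<theta> where "\<theta> n = inverse (real (Suc n))" for n
  have \<theta>: "\<And>n. \<theta> n > 0" "\<theta> \<longlonglongrightarrow> 0"
    unfolding \<theta>_def using LIMSEQ_inverse_real_of_nat by auto
  show "(\<lambda>n. \<bar>1 / \<theta> n * (\<phi> (t, x \<pi> t + \<theta> n *\<^sub>R a, x' \<pi> t + \<theta> n *\<^sub>R b, \<pi> + \<theta> n *\<^sub>R c)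
      - \<phi> (t, x \<pi> t, x' \<pi> t, \<pi>))\<bar>) \<longlonglongrightarrow> \<bar>D t \<pi> (a, b, c)\<bar>"
    by (intro tendsto_rabs quotient_tendsto iv ball_\<sigma> \<pi> t \<theta> tendsto_const)
  have small: "\<forall>\<^sub>F n in sequentially. norm (\<theta> n *\<^sub>R z) < \<rho> / 2" for z :: "'z::real_normed_vector"
  proof (rule order_tendstoD(2))
    show "(\<lambda>n. norm (\<theta> n *\<^sub>R z)) \<longlonglongrightarrow> 0"
      using tendsto_norm_zero[OF tendsto_scaleR[OF \<theta>(2) tendsto_const[of z], simplified]] .
  qed (use \<sigma> in auto)
  show "\<forall>\<^sub>F n in sequentially. \<bar>1 / \<theta> n * (\<phi> (t, x \<pi> t + \<theta> n *\<^sub>R a, x' \<pi> t + \<theta> n *\<^sub>R b, \<pi> + \<theta> n *\<^sub>R c)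
      - \<phi> (t, x \<pi> t, x' \<pi> t, \<pi>))\<bar> \<le> \<gamma> t * (norm a + norm b + norm c)"
    using small[of a] small[of b] small[of c]
    by eventually_elim (use quotient_bound[OF \<pi> t \<theta>(1)] in blast)
qed simp

text \<open>The directions \<open>a n\<close> and \<open>b n\<close> are independent continuous
  functions, not a function and its derivative. This generality allows one of them to vanish when
  the differential is split into partial terms.\<close>

lemma integral_quotient_tendsto:
  assumes iv: "cond_iv T \<phi> x \<pi>0 \<rho>" and \<pi>: "\<pi> \<in> ball \<pi>0 \<sigma>"
    and \<theta>: "\<And>n. \<theta> n > 0" "\<theta> \<longlonglongrightarrow> 0"
    and ab: "\<And>n. continuous_on {0..T} (a n)" "\<And>n. continuous_on {0..T} (b n)"
    and bd: "\<And>n t. t \<in> {0..T} \<Longrightarrow> norm (a n t) \<le> K" "\<And>n t. t \<in> {0..T} \<Longrightarrow> norm (b n t) \<le> K"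
      "\<And>n. norm (c n) \<le> K"
    and lim: "\<And>t. t \<in> {0..T} \<Longrightarrow> (\<lambda>n. a n t) \<longlonglongrightarrow> a' t" "\<And>t. t \<in> {0..T} \<Longrightarrow> (\<lambda>n. b n t) \<longlonglongrightarrow> b' t"
      "c \<longlonglongrightarrow> c'"
  shows "integrable (m1 T) (\<lambda>t. D t \<pi> (a' t, b' t, c'))"
    and "(\<lambda>n. 1 / \<theta> n * ((LINT t|m1 T. \<phi> (t, x \<pi> t + \<theta> n *\<^sub>R a n t, x' \<pi> t + \<theta> n *\<^sub>R b n t, \<pi> + \<theta> n *\<^sub>R c n))
        - (LINT t|m1 T. \<phi> (t, x \<pi> t, x' \<pi> t, \<pi>)))) \<longlonglongrightarrow> (LINT t|m1 T. D t \<pi> (a' t, b' t, c'))"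
proof -
  \<comment> \<open>From some index \<open>N\<close> on, all perturbations fit into the free half of
    \<rho>. Earlier terms may leave the domain where \<phi> is controlled, so the integral argument
    runs on sequences shifted by \<open>N\<close>; the limit does not notice.\<close>
  have "(\<lambda>n. \<theta> n * K) \<longlonglongrightarrow> 0" using \<theta>(2) tendsto_mult_left_zero by blast
  then have "\<forall>\<^sub>F n in sequentially. \<theta> n * K < \<rho> / 2"
    by (rule order_tendstoD(2)) (use \<sigma> in auto)
  then obtain N where N: "\<And>n. n \<ge> N \<Longrightarrow> \<theta> n * K < \<rho> / 2"
    unfolding eventually_sequentially by blast
  have small: "norm (\<theta> (n + N) *\<^sub>R z) < \<rho> / 2" if "norm z \<le> K" for z :: "'z::real_normed_vector" and n
    using le_less_trans[OF mult_left_mono[OF that less_imp_le[OF \<theta>(1)[of "n + N"]]] N[of "n + N"]]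
      \<theta>(1)[of "n + N"] by simp
  define f where "f n t = \<phi> (t, x \<pi> t + \<theta> n *\<^sub>R a n t, x' \<pi> t + \<theta> n *\<^sub>R b n t, \<pi> + \<theta> n *\<^sub>R c n)" for n t
  define f0 where "f0 t = \<phi> (t, x \<pi> t, x' \<pi> t, \<pi>)" for t
  define s where "s n t = 1 / \<theta> (n + N) * (f (n + N) t - f0 t)" for n t
  note x\<pi> = C1_continuous_on[OF T x_C1(1)[OF \<pi>]]
  have f: "integrable (m1 T) (f (n + N))" for n
    unfolding f_def
  proof (rule integrable_integrand)
    show "x \<pi> t + \<theta> (n + N) *\<^sub>R a (n + N) t \<in> M" if "t \<in> {0..T}" for t
      using near_ball(1)[OF \<pi> that, of "\<theta> (n + N) *\<^sub>R a (n + N) t" 0 0] ball_M[OF that] \<sigma>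
        small[OF bd(1)[OF that]] by auto
    show "\<pi> + \<theta> (n + N) *\<^sub>R c (n + N) \<in> P"
      using near_ball(3)[OF \<pi>, of 0 0 0 "\<theta> (n + N) *\<^sub>R c (n + N)"] ball_P \<sigma> small[OF bd(3)] T by auto
  qed (use ab x\<pi> in \<open>auto intro!: continuous_intros\<close>)
  have f0: "integrable (m1 T) f0"
    unfolding f0_def using x[OF ball_\<sigma>(2)[OF \<pi>]] ball_\<sigma>(2)[OF \<pi>] x\<pi>
    by (intro integrable_integrand) (auto simp: C1_into_def)
  have s: "integrable (m1 T) (s n)" for n
    unfolding s_def using f f0 by auto
  have sb: "\<bar>s n t\<bar> \<le> \<gamma> t * (K + K + K)" if t: "t \<in> {0..T}" for n t
  proof -
    have "\<bar>s n t\<bar> \<le> \<gamma> t * (norm (a (n + N) t) + norm (b (n + N) t) + norm (c (n + N)))"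
      unfolding s_def f_def f0_def
      by (intro quotient_bound \<pi> t \<theta> small bd)
    also have "\<dots> \<le> \<gamma> t * (K + K + K)"
      using t bd by (intro mult_left_mono \<gamma> add_mono) auto
    finally show ?thesis .
  qed
  have sl: "(\<lambda>n. s n t) \<longlonglongrightarrow> D t \<pi> (a' t, b' t, c')" if t: "t \<in> {0..T}" for t
    unfolding s_def f_def f0_def
    by (rule LIMSEQ_ignore_initial_segment) (intro quotient_tendsto iv ball_\<sigma> \<pi> t \<theta> lim)
  have g: "integrable (m1 T) (\<lambda>t. \<gamma> t * (K + K + K))" using \<gamma> by auto
  note dc = dominated_convergence_m1[OF s g sb sl]
  show "integrable (m1 T) (\<lambda>t. D t \<pi> (a' t, b' t, c'))" using dc(1) by simp
  have "(LINT t|m1 T. s n t) = 1 / \<theta> (n + N) * ((LINT t|m1 T. f (n + N) t) - (LINT t|m1 T. f0 t))" for n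
    unfolding s_def using f f0 by simp
  then have "(\<lambda>n. 1 / \<theta> (n + N) * ((LINT t|m1 T. f (n + N) t) - (LINT t|m1 T. f0 t)))
      \<longlonglongrightarrow> (LINT t|m1 T. D t \<pi> (a' t, b' t, c'))"
    using dc(2) by simp
  then show "(\<lambda>n. 1 / \<theta> n * ((LINT t|m1 T. \<phi> (t, x \<pi> t + \<theta> n *\<^sub>R a n t, x' \<pi> t + \<theta> n *\<^sub>R b n t, \<pi> + \<theta> n *\<^sub>R c n))
        - (LINT t|m1 T. \<phi> (t, x \<pi> t, x' \<pi> t, \<pi>)))) \<longlonglongrightarrow> (LINT t|m1 T. D t \<pi> (a' t, b' t, c'))"
    unfolding f_def f0_def by (rule LIMSEQ_offset)
qed

text \<open>Constant direction sequences suffice, bounded because \<open>a\<close> and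
  \<open>b\<close> are continuous on a compact interval.\<close>

lemma integrable_D:
  assumes iv: "cond_iv T \<phi> x \<pi>0 \<rho>" and \<pi>: "\<pi> \<in> ball \<pi>0 \<sigma>"
    and ab: "continuous_on {0..T} a" "continuous_on {0..T} b"
  shows "integrable (m1 T) (\<lambda>t. D t \<pi> (a t, b t, c))"
proof -
  obtain A where A: "\<And>t. t \<in> {0..T} \<Longrightarrow> norm (a t) \<le> A"
    using compact_imp_bounded[OF compact_continuous_image[OF ab(1) compact_Icc]] unfolding bounded_iff by blast
  obtain B where B: "\<And>t. t \<in> {0..T} \<Longrightarrow> norm (b t) \<le> B"
    using compact_imp_bounded[OF compact_continuous_image[OF ab(2) compact_Icc]] unfolding bounded_iff by blast
  show ?thesis
  proof (rule integral_quotient_tendsto(1)[OF iv \<pi>, where \<theta> = "\<lambda>n. inverse (real (Suc n))"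
        and a = "\<lambda>n. a" and b = "\<lambda>n. b" and c = "\<lambda>n. c" and K = "max A (max B (norm c))"])
    show "norm (a t) \<le> max A (max B (norm c))" if "t \<in> {0..T}" for t using A[OF that] by simp
    show "norm (b t) \<le> max A (max B (norm c))" if "t \<in> {0..T}" for t using B[OF that] by simp
  qed (use ab LIMSEQ_inverse_real_of_nat in auto)
qed

section \<open>The differential of the integral functional\<close>

definition DPhi :: "'y \<Rightarrow> (real \<Rightarrow> real^'n) \<times> 'y \<Rightarrow> real" where
  "DPhi \<pi> z = (LINT t|m1 T. D t \<pi> (fst z t, c1_deriv T (fst z) t, snd z))"

lemma integrable_DPhi:
  assumes "cond_iv T \<phi> x \<pi>0 \<rho>" "\<pi> \<in> ball \<pi>0 \<sigma>" "h \<in> C1 T"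
  shows "integrable (m1 T) (\<lambda>t. D t \<pi> (h t, c1_deriv T h t, \<omega>))"
  using assms C1_continuous_on[OF T assms(3)] by (intro integrable_D)

text \<open>A direction sequence converging in the product norm is bounded uniformly in time and
  converges at each time together with its derivative, which is what the limit theorem for the
  quotients asks for.\<close>

lemma Phi_variation:
  assumes iv: "cond_iv T \<phi> x \<pi>0 \<rho>" and \<pi>: "\<pi> \<in> ball \<pi>0 \<sigma>" and z: "z \<in> C1 T \<times> UNIV"
  shows "has_hadamard_variation (C1 T \<times> UNIV) (c1_prod_norm T) (Phi T \<phi>) (x \<pi>, \<pi>) z (DPhi \<pi> z)"
  unfolding has_hadamard_variation_def
proof (intro allI impI, elim conjE)
  fix \<theta> :: "nat \<Rightarrow> real" and w
  assume \<theta>: "\<forall>n. \<theta> n > 0" "\<theta> \<longlonglongrightarrow> 0" and w: "\<forall>n. w n \<in> C1 T \<times> UNIV"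
    and wz: "(\<lambda>n. c1_prod_norm T (w n - z)) \<longlonglongrightarrow> 0"
  obtain h \<omega> where z_eq: "z = (h, \<omega>)" and h: "h \<in> C1 T" using z by auto
  define a where "a n = fst (w n)" for n
  define c where "c n = snd (w n)" for n
  have a: "a n \<in> C1 T" for n using w[rule_format, of n] by (auto simp: a_def)
  obtain B where B: "\<And>n. c1_prod_norm T (w n - z) \<le> B"
    using convergent_imp_Bseq[OF convergentI[OF wz]] unfolding Bseq_def by (auto simp: abs_le_iff)
  have dist: "norm (a n t - h t) + norm (c1_deriv T (a n) t - c1_deriv T h t) + norm (c n - \<omega>)
      \<le> c1_prod_norm T (w n - z)" if "t \<in> {0..T}" for n t
    using norm_le_c1_norm_diff[OF T a h that, of n] by (simp add: c1_prod_norm_def z_eq a_def c_def)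
  have d: "norm (a n t - h t) \<le> c1_prod_norm T (w n - z)"
    "norm (c1_deriv T (a n) t - c1_deriv T h t) \<le> c1_prod_norm T (w n - z)"
    "norm (c n - \<omega>) \<le> c1_prod_norm T (w n - z)" if "t \<in> {0..T}" for n t
    using dist[OF that, of n] norm_ge_zero[of "a n t - h t"] norm_ge_zero[of "c n - \<omega>"]
      norm_ge_zero[of "c1_deriv T (a n) t - c1_deriv T h t"] by linarith+
  \<comment> \<open>Triangle inequality: \<open>B\<close> bounds the distance of \<open>w n\<close>
    from \<open>z\<close>, and the other two terms bound \<open>z\<close> itself.\<close>
  define K where "K = B + c1_norm T h + norm \<omega>"
  have "(\<lambda>n. 1 / \<theta> n * ((LINT t|m1 T. \<phi> (t, x \<pi> t + \<theta> n *\<^sub>R a n t,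
          x' \<pi> t + \<theta> n *\<^sub>R c1_deriv T (a n) t, \<pi> + \<theta> n *\<^sub>R c n))
        - (LINT t|m1 T. \<phi> (t, x \<pi> t, x' \<pi> t, \<pi>)))) \<longlonglongrightarrow> (LINT t|m1 T. D t \<pi> (h t, c1_deriv T h t, \<omega>))"
  proof (rule integral_quotient_tendsto(2)[OF iv \<pi>, where K = K])
    fix n and t :: real assume t: "t \<in> {0..T}"
    note hn = norm_le_c1_norm[OF T h t]
    show "norm (a n t) \<le> K"
      using norm_triangle_sub[of "a n t" "h t"] d(1)[OF t, of n] B[of n] hn
        norm_ge_zero[of "c1_deriv T h t"] norm_ge_zero[of \<omega>] unfolding K_def by linarith
    show "norm (c1_deriv T (a n) t) \<le> K"
      using norm_triangle_sub[of "c1_deriv T (a n) t" "c1_deriv T h t"] d(2)[OF t, of n] B[of n] hn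
        norm_ge_zero[of "h t"] norm_ge_zero[of \<omega>] unfolding K_def by linarith
  next
    \<comment> \<open>The estimate \<open>d(3)\<close> does not involve time but is stated for a
      time in the interval; time 0 serves, as \<open>T > 0\<close>.\<close>
    show "norm (c n) \<le> K" for n
      using norm_triangle_sub[of "c n" \<omega>] d(3)[of 0 n] T B[of n] c1_norm_nonneg[OF T h]
      unfolding K_def by auto
    show "(\<lambda>n. a n t) \<longlonglongrightarrow> h t" "(\<lambda>n. c1_deriv T (a n) t) \<longlonglongrightarrow> c1_deriv T h t" if "t \<in> {0..T}" for t
      by (rule LIM_zero_cancel, rule Lim_null_comparison[OF _ wz], use d[OF that] in simp)+
    show "c \<longlonglongrightarrow> \<omega>"
      by (rule LIM_zero_cancel, rule Lim_null_comparison[OF _ wz]) (use d(3)[of 0] T in auto)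
  qed (use \<theta> C1_continuous_on[OF T a] in auto)
  moreover have "Phi T \<phi> ((x \<pi>, \<pi>) + \<theta> n *\<^sub>R w n) = (LINT t|m1 T. \<phi> (t, x \<pi> t + \<theta> n *\<^sub>R a n t,
          x' \<pi> t + \<theta> n *\<^sub>R c1_deriv T (a n) t, \<pi> + \<theta> n *\<^sub>R c n))" for n
  proof -
    have "(x \<pi>, \<pi>) + \<theta> n *\<^sub>R w n = (x \<pi> + \<theta> n *\<^sub>R a n, \<pi> + \<theta> n *\<^sub>R c n)"
      by (simp add: prod_eq_iff a_def c_def)
    moreover have "c1_deriv T (x \<pi> + \<theta> n *\<^sub>R a n) t = x' \<pi> t + \<theta> n *\<^sub>R c1_deriv T (a n) t"
      if "t \<in> {0..T}" for t
      using that c1_deriv_add[OF T x_C1(1)[OF \<pi>] C1_scaleR[OF T a] that, of "\<theta> n" n] c1_deriv_scaleR[OF T a that]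
      by simp
    ultimately show ?thesis
      unfolding Phi_def by (auto simp: scaleR_fun_def intro!: Bochner_Integration.integral_cong)
  qed
  ultimately show "(\<lambda>n. (1 / \<theta> n) *\<^sub>R (Phi T \<phi> ((x \<pi>, \<pi>) + \<theta> n *\<^sub>R w n) - Phi T \<phi> (x \<pi>, \<pi>))) \<longlonglongrightarrow> DPhi \<pi> z"
    by (simp add: DPhi_def z_eq Phi_def)
qed

lemma c1_prod_norm_zero: "c1_prod_norm T 0 = 0"
  by (simp add: c1_prod_norm_def c1_norm_zero[OF T])

lemma Phi_differential:
  assumes "cond_iv T \<phi> x \<pi>0 \<rho>" "\<pi> \<in> ball \<pi>0 \<sigma>" "z \<in> C1 T \<times> UNIV"
  shows "hadamard_differential (C1 T \<times> UNIV) (c1_prod_norm T) (Phi T \<phi>) (x \<pi>, \<pi>) z = DPhi \<pi> z"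
  by (rule hadamard_differential_eqI[OF Phi_variation[OF assms] assms(3) c1_prod_norm_zero])

lemma D_add:
  assumes "cond_iv T \<phi> x \<pi>0 \<rho>" "\<pi> \<in> ball \<pi>0 \<sigma>" "t \<in> {0..T}"
  shows "D t \<pi> (a + a', b + b', c + c') = D t \<pi> (a, b, c) + D t \<pi> (a', b', c')"
  using bounded_linear.linear[OF D_bounded_linear[OF assms(1) ball_\<sigma>(1)[OF assms(2)] assms(3)]]
    linear_add[of "D t \<pi>" "(a, b, c)" "(a', b', c')"] by simp

lemma DPhi_bounded_linear_on:
  assumes iv: "cond_iv T \<phi> x \<pi>0 \<rho>" and \<pi>: "\<pi> \<in> ball \<pi>0 \<sigma>"
  shows "bounded_linear_on (C1 T \<times> UNIV) (c1_prod_norm T) (DPhi \<pi>)"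
  unfolding bounded_linear_on_def
proof (intro conjI ballI allI exI)
  fix v w :: "(real \<Rightarrow> real^'n) \<times> 'y" assume "v \<in> C1 T \<times> UNIV" "w \<in> C1 T \<times> UNIV"
  then have v: "fst v \<in> C1 T" and w: "fst w \<in> C1 T" by auto
  have "DPhi \<pi> (v + w) = (LINT t|m1 T. D t \<pi> (fst v t, c1_deriv T (fst v) t, snd v)
      + D t \<pi> (fst w t, c1_deriv T (fst w) t, snd w))"
    unfolding DPhi_def using D_add[OF iv \<pi>] c1_deriv_add[OF T v w]
    by (intro Bochner_Integration.integral_cong) auto
  then show "DPhi \<pi> (v + w) = DPhi \<pi> v + DPhi \<pi> w"
    using integrable_DPhi[OF iv \<pi> v] integrable_DPhi[OF iv \<pi> w] by (simp add: DPhi_def)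
next
  fix r and v :: "(real \<Rightarrow> real^'n) \<times> 'y" assume "v \<in> C1 T \<times> UNIV"
  then have v: "fst v \<in> C1 T" by auto
  have "DPhi \<pi> (r *\<^sub>R v) = (LINT t|m1 T. r * D t \<pi> (fst v t, c1_deriv T (fst v) t, snd v))"
    unfolding DPhi_def
  proof (intro Bochner_Integration.integral_cong refl)
    fix t assume "t \<in> space (m1 T)"
    then have t: "t \<in> {0..T}" by simp
    show "D t \<pi> (fst (r *\<^sub>R v) t, c1_deriv T (fst (r *\<^sub>R v)) t, snd (r *\<^sub>R v))
        = r * D t \<pi> (fst v t, c1_deriv T (fst v) t, snd v)"
      using linear_scale[OF bounded_linear.linear[OF D_bounded_linear[OF iv ball_\<sigma>(1)[OF \<pi>] t]],
          of r "(fst v t, c1_deriv T (fst v) t, snd v)"]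
      by (simp add: scaleR_fun_def[of r "fst v"] c1_deriv_scaleR[OF T v t, unfolded scaleR_fun_def])
  qed
  then show "DPhi \<pi> (r *\<^sub>R v) = r *\<^sub>R DPhi \<pi> v" by (simp add: DPhi_def)
next
  fix v :: "(real \<Rightarrow> real^'n) \<times> 'y" assume "v \<in> C1 T \<times> UNIV"
  then have v: "fst v \<in> C1 T" by auto
  \<comment> \<open>The bounding constant is the integral of \<gamma>, obtained by integrating the
    pointwise bound on the differential.\<close>
  have "norm (DPhi \<pi> v) \<le> (LINT t|m1 T. norm (D t \<pi> (fst v t, c1_deriv T (fst v) t, snd v)))"
    unfolding DPhi_def by (rule integral_norm_bound)
  also have "\<dots> \<le> (LINT t|m1 T. \<gamma> t * c1_prod_norm T v)"
  proof (rule integral_mono)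
    fix t assume "t \<in> space (m1 T)"
    then have t: "t \<in> {0..T}" by simp
    show "norm (D t \<pi> (fst v t, c1_deriv T (fst v) t, snd v)) \<le> \<gamma> t * c1_prod_norm T v"
      using order_trans[OF D_bound[OF iv \<pi> t, of "fst v t" "c1_deriv T (fst v) t" "snd v"]]
        mult_left_mono[OF _ \<gamma>(2)[OF t]] norm_le_c1_norm[OF T v t] by (simp add: c1_prod_norm_def)
  qed (use \<gamma> integrable_DPhi[OF iv \<pi> v] in auto)
  also have "\<dots> = (LINT t|m1 T. \<gamma> t) * c1_prod_norm T v" by simp
  finally show "norm (DPhi \<pi> v) \<le> (LINT t|m1 T. \<gamma> t) * c1_prod_norm T v" .
qed

lemma bounded_linear_on_Phi_differential:
  assumes iv: "cond_iv T \<phi> x \<pi>0 \<rho>" and \<pi>: "\<pi> \<in> ball \<pi>0 \<sigma>"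
  shows "bounded_linear_on (C1 T \<times> UNIV) (c1_prod_norm T)
    (hadamard_differential (C1 T \<times> UNIV) (c1_prod_norm T) (Phi T \<phi>) (x \<pi>, \<pi>))"
  by (rule bounded_linear_on_cong[OF DPhi_bounded_linear_on[OF iv \<pi>] Phi_differential[OF iv \<pi>]])
    (auto simp: C1_add[OF T] C1_scaleR[OF T])

lemma Phi_differentiable:
  assumes iv: "cond_iv T \<phi> x \<pi>0 \<rho>" and \<pi>: "\<pi> \<in> ball \<pi>0 \<sigma>"
  shows "hadamard_differentiable (C1 T \<times> UNIV) (c1_prod_norm T) (Phi T \<phi>) (x \<pi>, \<pi>)"
  unfolding hadamard_differentiable_def
  using Phi_variation[OF iv \<pi>] bounded_linear_on_Phi_differential[OF iv \<pi>] by blast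

section \<open>Partial differentials\<close>

text \<open>Embedding a component by zeros preserves the norm, so each partial variation is the
  joint variation in an embedded direction.\<close>

lemma D_partial:
  assumes iv: "cond_iv T \<phi> x \<pi>0 \<rho>" and \<pi>: "\<pi> \<in> ball \<pi>0 \<rho>" and t: "t \<in> {0..T}"
  shows "D_H2 \<phi> t (x \<pi> t) (x' \<pi> t) \<pi> a = D t \<pi> (a, 0, 0)"
    and "D_H3 \<phi> t (x \<pi> t) (x' \<pi> t) \<pi> b = D t \<pi> (0, b, 0)"
    and "D_H4 \<phi> t (x \<pi> t) (x' \<pi> t) \<pi> c = D t \<pi> (0, 0, c)"
    and "D_H23 \<phi> t (x \<pi> t) (x' \<pi> t) \<pi> (a, b) = D t \<pi> (a, b, 0)"
proof -
  have *: "has_hadamard_variation UNIV norm (\<lambda>(a, b, c). \<phi> (t, a, b, c)) (x \<pi> t, x' \<pi> t, \<pi>) z (D t \<pi> z)" for z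
    using iv \<pi> t unfolding cond_iv_def D_H234_exists_def D_H234_def
    by (intro has_hadamard_variation_differential) auto
  show "D_H2 \<phi> t (x \<pi> t) (x' \<pi> t) \<pi> a = D t \<pi> (a, 0, 0)"
    unfolding D_H2_def
    by (intro hadamard_differential_eqI has_hadamard_variation_slice[OF *, where J = "\<lambda>a. (a, 0, 0)"])
      (auto simp: norm_Pair)
  show "D_H3 \<phi> t (x \<pi> t) (x' \<pi> t) \<pi> b = D t \<pi> (0, b, 0)"
    unfolding D_H3_def
    by (intro hadamard_differential_eqI has_hadamard_variation_slice[OF *, where J = "\<lambda>b. (0, b, 0)"])
      (auto simp: norm_Pair)
  show "D_H4 \<phi> t (x \<pi> t) (x' \<pi> t) \<pi> c = D t \<pi> (0, 0, c)"
    unfolding D_H4_def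
    by (intro hadamard_differential_eqI has_hadamard_variation_slice[OF *, where J = "\<lambda>c. (0, 0, c)"])
      (auto simp: norm_Pair)
  show "D_H23 \<phi> t (x \<pi> t) (x' \<pi> t) \<pi> (a, b) = D t \<pi> (a, b, 0)"
    unfolding D_H23_def
    by (intro hadamard_differential_eqI
        has_hadamard_variation_slice[where J = "\<lambda>z. (fst z, snd z, 0)" and V = UNIV and N = norm
          and f = "\<lambda>(a, b, c). \<phi> (t, a, b, c)" and x = "(x \<pi> t, x' \<pi> t, \<pi>)"])
      (use *[of "(a, b, 0)"] in \<open>auto simp: norm_Pair\<close>)
qed

lemma DPhi_split:
  assumes iv: "cond_iv T \<phi> x \<pi>0 \<rho>" and \<pi>: "\<pi> \<in> ball \<pi>0 \<sigma>" and h: "h \<in> C1 T"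
  shows "integrable (m1 T) (\<lambda>t. D_H2 \<phi> t (x \<pi> t) (x' \<pi> t) \<pi> (h t))" (is "integrable _ ?f2")
    and "integrable (m1 T) (\<lambda>t. D_H3 \<phi> t (x \<pi> t) (x' \<pi> t) \<pi> (c1_deriv T h t))" (is "integrable _ ?f3")
    and "integrable (m1 T) (\<lambda>t. D_H4 \<phi> t (x \<pi> t) (x' \<pi> t) \<pi> \<omega>)" (is "integrable _ ?f4")
    and "DPhi \<pi> (h, \<omega>) = (LINT t|m1 T. D_H2 \<phi> t (x \<pi> t) (x' \<pi> t) \<pi> (h t))
      + (LINT t|m1 T. D_H3 \<phi> t (x \<pi> t) (x' \<pi> t) \<pi> (c1_deriv T h t))
      + (LINT t|m1 T. D_H4 \<phi> t (x \<pi> t) (x' \<pi> t) \<pi> \<omega>)"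
proof -
  note hc = C1_continuous_on[OF T h]
  note p = D_partial[OF iv ball_\<sigma>(1)[OF \<pi>]]
  show f2: "integrable (m1 T) ?f2"
    using integrable_D[OF iv \<pi> hc(1) continuous_on_const[of _ 0], of 0]
    by (rule Bochner_Integration.integrable_cong[THEN iffD1, rotated 2]) (auto simp: p)
  show f3: "integrable (m1 T) ?f3"
    using integrable_D[OF iv \<pi> continuous_on_const[of _ 0] hc(2), of 0]
    by (rule Bochner_Integration.integrable_cong[THEN iffD1, rotated 2]) (auto simp: p)
  show f4: "integrable (m1 T) ?f4"
    using integrable_D[OF iv \<pi> continuous_on_const[of _ 0] continuous_on_const[of _ 0], of \<omega>]
    by (rule Bochner_Integration.integrable_cong[THEN iffD1, rotated 2]) (auto simp: p)
  have "DPhi \<pi> (h, \<omega>) = (LINT t|m1 T. ?f2 t + ?f3 t + ?f4 t)"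
    unfolding DPhi_def
  proof (intro Bochner_Integration.integral_cong refl)
    fix t assume "t \<in> space (m1 T)"
    then have t: "t \<in> {0..T}" by simp
    show "D t \<pi> (fst (h, \<omega>) t, c1_deriv T (fst (h, \<omega>)) t, snd (h, \<omega>)) = ?f2 t + ?f3 t + ?f4 t"
      \<comment> \<open>Additivity is applied twice: it separates the parameter direction, then the
        position from the velocity.\<close>
      using D_add[OF iv \<pi> t, of "h t" 0 "c1_deriv T h t" 0 0 \<omega>] D_add[OF iv \<pi> t, of "h t" 0 0 "c1_deriv T h t" 0 0]
      by (simp add: p[OF t])
  qed
  then show "DPhi \<pi> (h, \<omega>) = (LINT t|m1 T. ?f2 t) + (LINT t|m1 T. ?f3 t) + (LINT t|m1 T. ?f4 t)"
    using f2 f3 f4 by simp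
qed

lemma Phi_partial_variation:
  assumes iv: "cond_iv T \<phi> x \<pi>0 \<rho>" and \<pi>: "\<pi> \<in> ball \<pi>0 \<sigma>" and h: "h \<in> C1 T"
  shows "has_hadamard_variation (C1 T) (c1_norm T) (\<lambda>y. Phi T \<phi> (y, \<pi>)) (x \<pi>) h (DPhi \<pi> (h, 0))"
  by (rule has_hadamard_variation_slice[OF Phi_variation[OF iv \<pi>], where J = "\<lambda>h. (h, 0)"])
    (use h in \<open>auto simp: c1_prod_norm_def\<close>)

lemma Phi_partial_differential:
  assumes "cond_iv T \<phi> x \<pi>0 \<rho>" "\<pi> \<in> ball \<pi>0 \<sigma>" "h \<in> C1 T"
  shows "hadamard_differential (C1 T) (c1_norm T) (\<lambda>y. Phi T \<phi> (y, \<pi>)) (x \<pi>) h = DPhi \<pi> (h, 0)"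
  by (intro hadamard_differential_eqI Phi_partial_variation assms c1_norm_zero T)

text \<open>Restriction of \<open>DPhi\<close> to directions \<open>(h, 0)\<close>; there the
  product norm equals \<open>c1_norm\<close>, so the same constant works.\<close>

lemma bounded_linear_on_Phi_partial_differential:
  assumes iv: "cond_iv T \<phi> x \<pi>0 \<rho>" and \<pi>: "\<pi> \<in> ball \<pi>0 \<sigma>"
  shows "bounded_linear_on (C1 T) (c1_norm T)
    (hadamard_differential (C1 T) (c1_norm T) (\<lambda>y. Phi T \<phi> (y, \<pi>)) (x \<pi>))"
proof -
  have bl: "bounded_linear_on (C1 T \<times> UNIV) (c1_prod_norm T) (DPhi \<pi>)"
    by (rule DPhi_bounded_linear_on[OF iv \<pi>])
  obtain K where K: "\<And>v. v \<in> C1 T \<times> UNIV \<Longrightarrow> norm (DPhi \<pi> v) \<le> K * c1_prod_norm T v"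
    using bl unfolding bounded_linear_on_def by blast
  have "bounded_linear_on (C1 T) (c1_norm T) (\<lambda>h. DPhi \<pi> (h, 0))"
    unfolding bounded_linear_on_def
  proof (intro conjI ballI allI exI)
    fix v w :: "real \<Rightarrow> real^'n" assume "v \<in> C1 T" "w \<in> C1 T"
    then have "DPhi \<pi> ((v, 0) + (w, 0)) = DPhi \<pi> (v, 0) + DPhi \<pi> (w, 0)"
      using bl unfolding bounded_linear_on_def by blast
    then show "DPhi \<pi> (v + w, 0) = DPhi \<pi> (v, 0) + DPhi \<pi> (w, 0)" by simp
  next
    fix r and v :: "real \<Rightarrow> real^'n" assume "v \<in> C1 T"
    then have "DPhi \<pi> (r *\<^sub>R (v, 0)) = r *\<^sub>R DPhi \<pi> (v, 0)"
      using bl unfolding bounded_linear_on_def by blast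
    then show "DPhi \<pi> (r *\<^sub>R v, 0) = r *\<^sub>R DPhi \<pi> (v, 0)" by simp
  next
    fix v :: "real \<Rightarrow> real^'n" assume "v \<in> C1 T"
    then show "norm (DPhi \<pi> (v, 0)) \<le> K * c1_norm T v"
      using K[of "(v, 0)"] by (simp add: c1_prod_norm_def)
  qed
  then show ?thesis
    by (rule bounded_linear_on_cong) (auto simp: Phi_partial_differential[OF iv \<pi>] C1_add[OF T] C1_scaleR[OF T])
qed

lemma Phi_partial_differentiable:
  assumes iv: "cond_iv T \<phi> x \<pi>0 \<rho>" and \<pi>: "\<pi> \<in> ball \<pi>0 \<sigma>"
  shows "hadamard_differentiable (C1 T) (c1_norm T) (\<lambda>y. Phi T \<phi> (y, \<pi>)) (x \<pi>)"
  unfolding hadamard_differentiable_def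
  using Phi_partial_variation[OF iv \<pi>] bounded_linear_on_Phi_partial_differential[OF iv \<pi>] by blast

section \<open>Continuous dependence of the differentials on the parameter\<close>

text \<open>Common core of the two continuity claims, which differ only in where the pointwise limit
  comes from; the partial differential is the case of zero parameter directions. The majorant
  \<open>2 * \<gamma>\<close> arises from \<open>D_bound\<close> at \<open>q n\<close> and at
  \<open>p\<close>, for directions of total norm at most 1.\<close>

lemma DPhi_tendsto_diff:
  assumes iv: "cond_iv T \<phi> x \<pi>0 \<rho>" and p: "p \<in> ball \<pi>0 \<sigma>" and q: "\<And>n. q n \<in> ball \<pi>0 \<sigma>"
    and h: "\<And>n. h n \<in> C1 T" and N: "\<And>n. c1_prod_norm T (h n, \<omega> n) \<le> 1"
    and lim: "\<And>t. t \<in> {0..T} \<Longrightarrow> (\<lambda>n. D t (q n) (h n t, c1_deriv T (h n) t, \<omega> n)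
        - D t p (h n t, c1_deriv T (h n) t, \<omega> n)) \<longlonglongrightarrow> 0"
  shows "(\<lambda>n. DPhi (q n) (h n, \<omega> n) - DPhi p (h n, \<omega> n)) \<longlonglongrightarrow> 0"
proof -
  define s where "s n t = D t (q n) (h n t, c1_deriv T (h n) t, \<omega> n)
      - D t p (h n t, c1_deriv T (h n) t, \<omega> n)" for n t
  note I = integrable_DPhi[OF iv q h] integrable_DPhi[OF iv p h]
  have "(\<lambda>n. LINT t|m1 T. s n t) \<longlonglongrightarrow> (LINT t|m1 T. 0)"
  proof (rule dominated_convergence_m1)
    show "integrable (m1 T) (s n)" for n unfolding s_def using I by auto
    show "integrable (m1 T) (\<lambda>t. 2 * \<gamma> t)" using \<gamma> by auto
    show "\<bar>s n t\<bar> \<le> 2 * \<gamma> t" if t: "t \<in> {0..T}" for n t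
    proof -
      have "norm (h n t) + norm (c1_deriv T (h n) t) + norm (\<omega> n) \<le> 1"
        using norm_le_c1_norm[OF T h t, of n] N[of n] by (simp add: c1_prod_norm_def)
      then have "\<gamma> t * (norm (h n t) + norm (c1_deriv T (h n) t) + norm (\<omega> n)) \<le> \<gamma> t"
        using mult_left_mono[OF _ \<gamma>(2)[OF t]] by fastforce
      then show ?thesis
        using D_bound[OF iv q t, of n "h n t" "c1_deriv T (h n) t" "\<omega> n"]
          D_bound[OF iv p t, of "h n t" "c1_deriv T (h n) t" "\<omega> n"] unfolding s_def by linarith
    qed
    show "(\<lambda>n. s n t) \<longlonglongrightarrow> 0" if "t \<in> {0..T}" for t
      unfolding s_def by (rule lim[OF that])
  qed
  moreover have "(LINT t|m1 T. s n t) = DPhi (q n) (h n, \<omega> n) - DPhi p (h n, \<omega> n)" for n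
    unfolding s_def DPhi_def using I by simp
  ultimately show ?thesis by simp
qed

lemma Phi_differential_continuous:
  assumes iv: "cond_iv T \<phi> x \<pi>0 \<rho>" and vi: "cond_vi T \<phi> x \<pi>0 \<rho>"
  shows "continuous_into_dual (C1 T \<times> UNIV) (c1_prod_norm T) (ball \<pi>0 \<sigma>)
    (\<lambda>\<pi>. hadamard_differential (C1 T \<times> UNIV) (c1_prod_norm T) (Phi T \<phi>) (x \<pi>, \<pi>))"
proof (rule continuous_into_dualI)
  show "bounded_linear_on (C1 T \<times> UNIV) (c1_prod_norm T)
      (hadamard_differential (C1 T \<times> UNIV) (c1_prod_norm T) (Phi T \<phi>) (x p, p))"
    if "p \<in> ball \<pi>0 \<sigma>" for p
    by (rule bounded_linear_on_Phi_differential[OF iv that])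
  fix p q and v :: "nat \<Rightarrow> (real \<Rightarrow> real^'n) \<times> 'y"
  assume p: "p \<in> ball \<pi>0 \<sigma>" and q: "\<And>n. q n \<in> ball \<pi>0 \<sigma>" "q \<longlonglongrightarrow> p"
    and v: "\<And>n. v n \<in> C1 T \<times> UNIV" "\<And>n. c1_prod_norm T (v n) \<le> 1"
  define h where "h n = fst (v n)" for n
  define \<omega> where "\<omega> n = snd (v n)" for n
  have v_eq: "v n = (h n, \<omega> n)" for n by (simp add: h_def \<omega>_def)
  have h: "h n \<in> C1 T" for n using v(1)[of n] by (simp add: v_eq)
  have N: "c1_prod_norm T (h n, \<omega> n) \<le> 1" for n using v(2)[of n] by (simp add: v_eq)
  have "(\<lambda>n. DPhi (q n) (h n, \<omega> n) - DPhi p (h n, \<omega> n)) \<longlonglongrightarrow> 0"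
  proof (rule DPhi_tendsto_diff[OF iv p q(1) h N])
    fix t :: real assume t: "t \<in> {0..T}"
    \<comment> \<open>The norm on triples is the Euclidean combination, whereas
      \<open>c1_prod_norm\<close> adds; the sum dominates.\<close>
    have "norm (h n t, c1_deriv T (h n) t, \<omega> n) \<le> 1" for n
      using norm_triple_le[of "h n t" "c1_deriv T (h n) t" "\<omega> n"] norm_le_c1_norm[OF T h t, of n] N[of n]
      by (simp add: c1_prod_norm_def)
    then show "(\<lambda>n. D t (q n) (h n t, c1_deriv T (h n) t, \<omega> n)
        - D t p (h n t, c1_deriv T (h n) t, \<omega> n)) \<longlonglongrightarrow> 0"
      using vi t unfolding cond_vi_def
      by (intro Blinfun_continuous_tendsto_diff[where S = "ball \<pi>0 \<rho>" and K = 1])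
        (use D_bounded_linear[OF iv] p q ball_\<sigma>(1) in blast)+
  qed
  then show "(\<lambda>n. hadamard_differential (C1 T \<times> UNIV) (c1_prod_norm T) (Phi T \<phi>) (x (q n), q n) (v n)
      - hadamard_differential (C1 T \<times> UNIV) (c1_prod_norm T) (Phi T \<phi>) (x p, p) (v n)) \<longlonglongrightarrow> 0"
    by (simp add: Phi_differential[OF iv p] Phi_differential[OF iv q(1)] h v_eq)
qed (auto simp: c1_prod_norm_zero C1_zero[OF T] c1_prod_norm_def zero_prod_def c1_norm_nonneg[OF T]
    c1_norm_zero[OF T])

lemma Phi_partial_differential_continuous:
  assumes iv: "cond_iv T \<phi> x \<pi>0 \<rho>" and v: "cond_v T \<phi> x \<pi>0 \<rho>"
  shows "continuous_into_dual (C1 T) (c1_norm T) (ball \<pi>0 \<sigma>)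
    (\<lambda>\<pi>. hadamard_differential (C1 T) (c1_norm T) (\<lambda>y. Phi T \<phi> (y, \<pi>)) (x \<pi>))"
proof (rule continuous_into_dualI)
  show "bounded_linear_on (C1 T) (c1_norm T)
      (hadamard_differential (C1 T) (c1_norm T) (\<lambda>y. Phi T \<phi> (y, p)) (x p))" if "p \<in> ball \<pi>0 \<sigma>" for p
    by (rule bounded_linear_on_Phi_partial_differential[OF iv that])
  fix p q and h :: "nat \<Rightarrow> real \<Rightarrow> real^'n"
  assume p: "p \<in> ball \<pi>0 \<sigma>" and q: "\<And>n. q n \<in> ball \<pi>0 \<sigma>" "q \<longlonglongrightarrow> p"
    and h: "\<And>n. h n \<in> C1 T" and N: "\<And>n. c1_norm T (h n) \<le> 1"
  let ?L = "\<lambda>t p. D_H23 \<phi> t (x p t) (x' p t) p"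
  have "(\<lambda>n. DPhi (q n) (h n, 0) - DPhi p (h n, 0)) \<longlonglongrightarrow> 0"
  proof (rule DPhi_tendsto_diff[OF iv p q(1) h])
    show "c1_prod_norm T (h n, 0 :: 'y) \<le> 1" for n using N by (simp add: c1_prod_norm_def)
    fix t :: real assume t: "t \<in> {0..T}"
    \<comment> \<open>As the composition of the joint differential with the inclusion by zero,
      \<open>D_H23\<close> is bounded linear, so continuity of its \<open>Blinfun\<close> image
      speaks about the functional itself.\<close>
    have D23: "?L t p = (\<lambda>z. D t p (fst z, snd z, 0))" if "p \<in> ball \<pi>0 \<rho>" for p
      using D_partial(4)[OF iv that t] by auto
    have bl: "bounded_linear (?L t p)" if "p \<in> ball \<pi>0 \<rho>" for p
      unfolding D23[OF that]
      by (rule bounded_linear_compose[OF D_bounded_linear[OF iv that t]])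
        (intro bounded_linear_Pair bounded_linear_fst bounded_linear_snd bounded_linear_zero)
    have "norm (h n t, c1_deriv T (h n) t) \<le> 1" for n
      using norm_Pair_le[of "h n t" "c1_deriv T (h n) t"] norm_le_c1_norm[OF T h t, of n] N[of n]
      by linarith
    then have "(\<lambda>n. ?L t (q n) (h n t, c1_deriv T (h n) t) - ?L t p (h n t, c1_deriv T (h n) t)) \<longlonglongrightarrow> 0"
      using v t unfolding cond_v_def
      by (intro Blinfun_continuous_tendsto_diff[where S = "ball \<pi>0 \<rho>" and K = 1])
        (use bl p q ball_\<sigma>(1) in blast)+
    then show "(\<lambda>n. D t (q n) (h n t, c1_deriv T (h n) t, 0) - D t p (h n t, c1_deriv T (h n) t, 0)) \<longlonglongrightarrow> 0"
      by (simp add: D_partial(4)[OF iv ball_\<sigma>(1)[OF p] t] D_partial(4)[OF iv ball_\<sigma>(1)[OF q(1)] t])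
  qed
  then show "(\<lambda>n. hadamard_differential (C1 T) (c1_norm T) (\<lambda>y. Phi T \<phi> (y, q n)) (x (q n)) (h n)
      - hadamard_differential (C1 T) (c1_norm T) (\<lambda>y. Phi T \<phi> (y, p)) (x p) (h n)) \<longlonglongrightarrow> 0"
    by (simp add: Phi_partial_differential[OF iv p] Phi_partial_differential[OF iv q(1)] h)
qed (auto simp: C1_zero[OF T] c1_norm_nonneg[OF T] c1_norm_zero[OF T])

section \<open>Lipschitz continuity in the trajectory\<close>

lemma c1_ball_near:
  assumes \<pi>: "\<pi> \<in> ball \<pi>0 \<sigma>" and y: "y \<in> c1_ball T (x \<pi>) \<sigma>" and t: "t \<in> {0..T}"
  shows "y t \<in> ball (x \<pi>0 t) \<rho>" "c1_deriv T y t \<in> ball (x' \<pi>0 t) \<rho>"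
proof -
  have yC: "y \<in> C1 T" and n: "c1_norm T (y - x \<pi>) < \<sigma>" using y by (auto simp: c1_ball_def)
  note le = norm_le_c1_norm_diff[OF T yC x_C1(1)[OF \<pi>] t]
  have "norm (y t - x \<pi> t) < \<rho> / 2" "norm (c1_deriv T y t - x' \<pi> t) < \<rho> / 2"
    using le n \<sigma> norm_ge_zero[of "y t - x \<pi> t"] norm_ge_zero[of "c1_deriv T y t - x' \<pi> t"] by linarith+
  then show "y t \<in> ball (x \<pi>0 t) \<rho>" "c1_deriv T y t \<in> ball (x' \<pi>0 t) \<rho>"
    using near_ball(1,2)[OF \<pi> t, of "y t - x \<pi> t" "c1_deriv T y t - x' \<pi> t" 0] \<sigma> by auto
qed

text \<open>Ensures that the Lipschitz estimate compares only trajectories with values in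
  \<open>M\<close>, where the functional is defined.\<close>

lemma c1_ball_subset: "\<pi> \<in> ball \<pi>0 \<sigma> \<Longrightarrow> c1_ball T (x \<pi>) \<sigma> \<subseteq> C1_into T M"
  using c1_ball_near(1) ball_M by (fastforce simp: C1_into_def c1_ball_def)

text \<open>Integrating the Lipschitz condition with equal parameters gives the integral of \<gamma>
  as constant, the same for all \<pi> in the ball.\<close>

lemma Phi_lipschitz:
  assumes \<pi>: "\<pi> \<in> ball \<pi>0 \<sigma>" and y: "y \<in> c1_ball T (x \<pi>) \<sigma>" and z: "z \<in> c1_ball T (x \<pi>) \<sigma>"
  shows "\<bar>Phi T \<phi> (y, \<pi>) - Phi T \<phi> (z, \<pi>)\<bar> \<le> (LINT t|m1 T. \<gamma> t) * c1_norm T (y - z)"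
proof -
  have C: "w \<in> C1 T" "\<And>t. t \<in> {0..T} \<Longrightarrow> w t \<in> M" if "w \<in> c1_ball T (x \<pi>) \<sigma>" for w
    using c1_ball_subset[OF \<pi>] that by (auto simp: C1_into_def)
  have I: "integrable (m1 T) (\<lambda>t. \<phi> (t, w t, c1_deriv T w t, \<pi>))" if "w \<in> c1_ball T (x \<pi>) \<sigma>" for w
    using C[OF that] C1_continuous_on[OF T C(1)[OF that]] ball_\<sigma>(2)[OF \<pi>] by (intro integrable_integrand)
  have "\<bar>Phi T \<phi> (y, \<pi>) - Phi T \<phi> (z, \<pi>)\<bar>
      = norm (LINT t|m1 T. \<phi> (t, y t, c1_deriv T y t, \<pi>) - \<phi> (t, z t, c1_deriv T z t, \<pi>))"
    using I[OF y] I[OF z] by (simp add: Phi_def)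
  also have "\<dots> \<le> (LINT t|m1 T. norm (\<phi> (t, y t, c1_deriv T y t, \<pi>) - \<phi> (t, z t, c1_deriv T z t, \<pi>)))"
    by (rule integral_norm_bound)
  also have "\<dots> \<le> (LINT t|m1 T. \<gamma> t * c1_norm T (y - z))"
  proof (rule integral_mono)
    fix t assume "t \<in> space (m1 T)"
    then have t: "t \<in> {0..T}" by simp
    have "norm (\<phi> (t, y t, c1_deriv T y t, \<pi>) - \<phi> (t, z t, c1_deriv T z t, \<pi>))
        \<le> \<gamma> t * (norm (y t - z t) + norm (c1_deriv T y t - c1_deriv T z t) + norm (\<pi> - \<pi>))"
      unfolding real_norm_def by (intro lip t c1_ball_near[OF \<pi>] y z ball_\<sigma>(1) \<pi>)
    also have "\<dots> \<le> \<gamma> t * c1_norm T (y - z)"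
      using norm_le_c1_norm_diff[OF T C(1)[OF y] C(1)[OF z] t] by (intro mult_left_mono \<gamma> t) auto
    finally show "norm (\<phi> (t, y t, c1_deriv T y t, \<pi>) - \<phi> (t, z t, c1_deriv T z t, \<pi>))
        \<le> \<gamma> t * c1_norm T (y - z)" .
  qed (use I[OF y] I[OF z] \<gamma> in auto)
  finally show ?thesis by simp
qed

end

theorem lemma5p5:
  fixes T :: real
    and M :: "(real^'n) set"
    and P :: "'y::real_normed_vector set"
    and \<phi> :: "real \<times> (real^'n) \<times> (real^'n) \<times> 'y \<Rightarrow> real"
    and \<pi>0 :: 'y
    and x :: "'y \<Rightarrow> real \<Rightarrow> real^'n"
    and \<rho> :: real
  assumes T: "T > 0"
    and M: "open M"
    and P: "open P"
    and \<pi>0: "\<pi>0 \<in> P"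
    and x: "\<And>\<pi>. \<pi> \<in> P \<Longrightarrow> x \<pi> \<in> C1_into T M"
    and i: "continuous_on ({0..T} \<times> M \<times> UNIV \<times> P) \<phi>"
    and ii: "((\<lambda>\<pi>. c1_norm T (x \<pi> - x \<pi>0)) \<longlongrightarrow> 0) (at \<pi>0 within P)"
    and \<rho>: "\<rho> > 0" "\<And>t. t \<in> {0..T} \<Longrightarrow> ball (x \<pi>0 t) \<rho> \<subseteq> M" "ball \<pi>0 \<rho> \<subseteq> P"
    and iii: "\<exists>\<gamma>. integrable (m1 T) \<gamma> \<and> (\<forall>t\<in>{0..T}. \<gamma> t \<ge> 0) \<and>
      (\<forall>t\<in>{0..T}. \<forall>u\<in>ball (x \<pi>0 t) \<rho>. \<forall>u1\<in>ball (x \<pi>0 t) \<rho>.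
        \<forall>v\<in>ball (c1_deriv T (x \<pi>0) t) \<rho>. \<forall>v1\<in>ball (c1_deriv T (x \<pi>0) t) \<rho>.
        \<forall>\<pi>\<in>ball \<pi>0 \<rho>. \<forall>\<pi>1\<in>ball \<pi>0 \<rho>.
          \<bar>\<phi> (t, u, v, \<pi>) - \<phi> (t, u1, v1, \<pi>1)\<bar>
            \<le> \<gamma> t * (norm (u - u1) + norm (v - v1) + norm (\<pi> - \<pi>1)))"
  shows "\<exists>\<sigma>. 0 < \<sigma> \<and> \<sigma> \<le> \<rho> \<and>
    \<comment> \<open>(a)\<close>
    (\<forall>\<pi>\<in>ball \<pi>0 \<sigma>. c1_ball T (x \<pi>) \<sigma> \<subseteq> C1_into T M \<and>
      (\<exists>L\<ge>0. \<forall>y\<in>c1_ball T (x \<pi>) \<sigma>. \<forall>z\<in>c1_ball T (x \<pi>) \<sigma>.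
        \<bar>Phi T \<phi> (y, \<pi>) - Phi T \<phi> (z, \<pi>)\<bar> \<le> L * c1_norm T (y - z))) \<and>
    \<comment> \<open>(b)\<close>
    (cond_iv T \<phi> x \<pi>0 \<rho> \<longrightarrow>
      (\<forall>\<pi>\<in>ball \<pi>0 \<sigma>.
        hadamard_differentiable (C1 T \<times> UNIV) (c1_prod_norm T) (Phi T \<phi>) (x \<pi>, \<pi>) \<and>
        (\<forall>h\<in>C1 T. \<forall>\<omega>.
          integrable (m1 T) (\<lambda>t. D_H234 \<phi> t (x \<pi> t) (c1_deriv T (x \<pi>) t) \<pi> (h t, c1_deriv T h t, \<omega>)) \<and>
          integrable (m1 T) (\<lambda>t. D_H2 \<phi> t (x \<pi> t) (c1_deriv T (x \<pi>) t) \<pi> (h t)) \<and>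
          integrable (m1 T) (\<lambda>t. D_H3 \<phi> t (x \<pi> t) (c1_deriv T (x \<pi>) t) \<pi> (c1_deriv T h t)) \<and>
          integrable (m1 T) (\<lambda>t. D_H4 \<phi> t (x \<pi> t) (c1_deriv T (x \<pi>) t) \<pi> \<omega>) \<and>
          hadamard_differential (C1 T \<times> UNIV) (c1_prod_norm T) (Phi T \<phi>) (x \<pi>, \<pi>) (h, \<omega>) =
            (LINT t|m1 T. D_H2 \<phi> t (x \<pi> t) (c1_deriv T (x \<pi>) t) \<pi> (h t)) +
            (LINT t|m1 T. D_H3 \<phi> t (x \<pi> t) (c1_deriv T (x \<pi>) t) \<pi> (c1_deriv T h t)) +
            (LINT t|m1 T. D_H4 \<phi> t (x \<pi> t) (c1_deriv T (x \<pi>) t) \<pi> \<omega>)))) \<and>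
    \<comment> \<open>(c)\<close>
    (cond_iv T \<phi> x \<pi>0 \<rho> \<and> cond_v T \<phi> x \<pi>0 \<rho> \<longrightarrow>
      (\<forall>\<pi>\<in>ball \<pi>0 \<sigma>. hadamard_differentiable (C1 T) (c1_norm T) (\<lambda>y. Phi T \<phi> (y, \<pi>)) (x \<pi>)) \<and>
      continuous_into_dual (C1 T) (c1_norm T) (ball \<pi>0 \<sigma>)
        (\<lambda>\<pi>. hadamard_differential (C1 T) (c1_norm T) (\<lambda>y. Phi T \<phi> (y, \<pi>)) (x \<pi>))) \<and>
    \<comment> \<open>(d)\<close>
    (cond_iv T \<phi> x \<pi>0 \<rho> \<and> cond_v T \<phi> x \<pi>0 \<rho> \<and> cond_vi T \<phi> x \<pi>0 \<rho> \<and> cond_vii T \<phi> x \<pi>0 \<rho> \<longrightarrow>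
      continuous_into_dual (C1 T \<times> UNIV) (c1_prod_norm T) (ball \<pi>0 \<sigma>)
        (\<lambda>\<pi>. hadamard_differential (C1 T \<times> UNIV) (c1_prod_norm T) (Phi T \<phi>) (x \<pi>, \<pi>)))"
proof -
  from iii obtain \<gamma> where \<gamma>: "integrable (m1 T) \<gamma>" "\<forall>t\<in>{0..T}. \<gamma> t \<ge> 0"
    and lip: "\<forall>t\<in>{0..T}. \<forall>u\<in>ball (x \<pi>0 t) \<rho>. \<forall>u1\<in>ball (x \<pi>0 t) \<rho>.
        \<forall>v\<in>ball (c1_deriv T (x \<pi>0) t) \<rho>. \<forall>v1\<in>ball (c1_deriv T (x \<pi>0) t) \<rho>.
        \<forall>\<pi>\<in>ball \<pi>0 \<rho>. \<forall>\<pi>1\<in>ball \<pi>0 \<rho>.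
          \<bar>\<phi> (t, u, v, \<pi>) - \<phi> (t, u1, v1, \<pi>1)\<bar>
            \<le> \<gamma> t * (norm (u - u1) + norm (v - v1) + norm (\<pi> - \<pi>1))"
    by (elim exE conjE)
  have "\<forall>\<^sub>F \<pi> in at \<pi>0 within P. c1_norm T (x \<pi> - x \<pi>0) < \<rho> / 2"
    using order_tendstoD(2)[OF ii, of "\<rho> / 2"] \<rho>(1) by simp
  then obtain d where d: "d > 0"
    "\<And>\<pi>. \<pi> \<in> P \<Longrightarrow> \<pi> \<noteq> \<pi>0 \<Longrightarrow> dist \<pi> \<pi>0 < d \<Longrightarrow> c1_norm T (x \<pi> - x \<pi>0) < \<rho> / 2"
    unfolding eventually_at by auto
  \<comment> \<open>The bound \<open>d\<close> keeps the trajectory within \<rho>/2 of the reference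
    one; the bound \<rho>/2 limits both the parameter and the radius of the C1 balls.\<close>
  define \<sigma> where "\<sigma> = min d (\<rho> / 2)"
  have near: "c1_norm T (x \<pi> - x \<pi>0) < \<rho> / 2" if "\<pi> \<in> ball \<pi>0 \<sigma>" for \<pi>
  \<comment> \<open>The limit at \<pi>0 says nothing about \<pi>0 itself, where the difference of
    trajectories is zero.\<close>
  proof (cases "\<pi> = \<pi>0")
    case True
    then show ?thesis using \<rho>(1) by (simp add: c1_norm_zero[OF T])
  next
    case False
    have "\<pi> \<in> ball \<pi>0 \<rho>" using that \<rho>(1) by (auto simp: \<sigma>_def)
    with False show ?thesis using d(2)[of \<pi>] that \<rho>(3) by (auto simp: \<sigma>_def dist_commute)
  qed
  interpret integral_functional T M P \<phi> \<pi>0 x \<rho> \<sigma> \<gamma>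
    by (unfold_locales, fact T, fact x, fact i, fact \<rho>(2), fact \<rho>(3), fact \<gamma>(1), rule \<gamma>(2)[rule_format],
        assumption, rule lip[rule_format]) (use \<rho>(1) near d(1) in \<open>auto simp: \<sigma>_def\<close>)
  have \<sigma>\<rho>: "\<sigma> \<le> \<rho>" using \<rho>(1) by (simp add: \<sigma>_def)
  have \<gamma>0: "0 \<le> (LINT t|m1 T. \<gamma> t)" by (rule Bochner_Integration.integral_nonneg) (use \<gamma>(2) in auto)
  have lipschitz: "\<exists>L\<ge>0. \<forall>y\<in>c1_ball T (x \<pi>) \<sigma>. \<forall>z\<in>c1_ball T (x \<pi>) \<sigma>.
      \<bar>Phi T \<phi> (y, \<pi>) - Phi T \<phi> (z, \<pi>)\<bar> \<le> L * c1_norm T (y - z)" if "\<pi> \<in> ball \<pi>0 \<sigma>" for \<pi>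
    using \<gamma>0 Phi_lipschitz[OF that] by (intro exI[of _ "LINT t|m1 T. \<gamma> t"]) blast
  have formula: "hadamard_differential (C1 T \<times> UNIV) (c1_prod_norm T) (Phi T \<phi>) (x \<pi>, \<pi>) (h, \<omega>) =
      (LINT t|m1 T. D_H2 \<phi> t (x \<pi> t) (c1_deriv T (x \<pi>) t) \<pi> (h t)) +
      (LINT t|m1 T. D_H3 \<phi> t (x \<pi> t) (c1_deriv T (x \<pi>) t) \<pi> (c1_deriv T h t)) +
      (LINT t|m1 T. D_H4 \<phi> t (x \<pi> t) (c1_deriv T (x \<pi>) t) \<pi> \<omega>)"
    if "cond_iv T \<phi> x \<pi>0 \<rho>" "\<pi> \<in> ball \<pi>0 \<sigma>" "h \<in> C1 T" for \<pi> h \<omega>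
    using DPhi_split(4)[OF that] Phi_differential[OF that(1,2), of "(h, \<omega>)"] that(3) by simp
  show ?thesis
    by (rule exI[of _ \<sigma>], intro conjI impI ballI allI; (elim conjE)?;
        (rule \<sigma>(1) \<sigma>\<rho> c1_ball_subset lipschitz Phi_differentiable integrable_DPhi DPhi_split(1-3)
          formula Phi_partial_differentiable Phi_partial_differential_continuous
          Phi_differential_continuous; assumption))
qed

end
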